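(* Assume $0<\kappa_*\le\kappa^*<1$. The generalized eigenvalue problems $\mathcal K z=\lambda\mathcal M z$ and $\hat{\mathcal K}\hat z=\lambda\hat{\mathcal M}\hat z$ have the same non-infinite eigenvalues, and $$\mathrm{Spec}(\hat{\mathcal K},\hat{\mathcal M})=\mathrm{Spec}(\mathcal K,\mathcal M)\setminus\{\infty\}_{k=1}^{n_t},$$ i.e. the spectrum of the second pencil is obtained from that of the first by removing $n_t$ copies of the eigenvalue $\infty$.
   Context: Let $\Omega\subset\mathbb{R}^d$, $d\in\{2,3\}$, be a bounded connected polygon ($d=2$) or polyhedron ($d=3$). Let $A:\Omega\to\mathbb{R}^{d\times d}$ be a measurable matrix field that is symmetric positive definite everywhere, and set $\kappa_*:=\inf_{x\in\Omega}\inf_{|\xi|=1}\xi^\top A(x)\xi$ and $\kappa^*:=\sup_{x\in\Omega}\sup_{|\xi|=1}\xi^\top A(x)\xi$, where $\xi\in\mathbb{R}^d$ and $|\cdot|$ is the Euclidean norm. Let $I$ be the identity matrix and $P:=(A^{-1}-I)^{-1}$ (pointwise in $x$). $(\cdot,\cdot)$ is the $L^2(\Omega)$ inner product. Let $\mathcal T_h$ be a triangular/tetrahedral mesh of $\Omega$; $\mathcal L_h$ the space of continuous piecewise linear functions on it, $\mathcal L_{h0}=\mathcal L_h\cap H^1_0(\Omega)$, and $\mathcal C_h^d$ the space of $\mathbb{R}^d$-valued piecewise constant functions. Let $n_{e_0},n_t,n_e$ be the dimensions of $\mathcal L_{h0},\mathcal C_h^d,\mathcal L_h$, with $n_{e_0}\ge1$.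 Let $\{\phi_1,\dots,\phi_{n_e}\}$ be the nodal finite element basis of $\mathcal L_h$, ordered so that $\{\phi_1,\dots,\phi_{n_{e_0}}\}$ is the basis of $\mathcal L_{h0}$, and $\{\chi_1,\dots,\chi_{n_t}\}$ a basis of $\mathcal C_h^d$. Define matrices $(K_P)_{ij}=(P\nabla\phi_j,\nabla\phi_i)$ ($n_{e_0}\times n_{e_0}$), $(F_P)_{ij}=(P\chi_j,\nabla\phi_i)$ ($n_{e_0}\times n_t$), $(M_P)_{ij}=((I+P)\chi_j,\chi_i)$ ($n_t\times n_t$), $G_{ij}=(\nabla\phi_j,\chi_i)$ ($n_t\times n_e$), $X_{ij}=(\phi_j,\phi_i)$ ($n_{e_0}\times n_{e_0}$), $Y_{ij}=(\phi_j,\phi_i)$ ($n_{e_0}\times n_e$), and vectors $\alpha=[(\phi_1,1),\dots,(\phi_{n_{e_0}},1)]^\top$, $\beta=[(\phi_1,1),\dots,(\phi_{n_e},1)]^\top$. Set $$\mathcal K=\begin{bmatrix} K_P & F_P & O & \alpha & O \\ F_P^\top & M_P & -G & O & O \\ O & -G^\top & O & O & \beta \\ \alpha^\top & O & O & O & O \\ O & O & \beta^\top & O & O \end{bmatrix},\qquad \mathcal M=\begin{bmatrix} X & O & Y & O & O \\ O & O & O & O & O \\ Y^\top & O & O & O & O \\ O & O & O & O & O \\ O & O & O & O & O \end{bmatrix},$$ $$\hat K=K_P-F_PM_P^{-1}F_P^\top,\quad \hat F=F_PM_P^{-1}G,\quad \hat G=-G^\top M_P^{-1}G,$$ $$\hat{\mathcal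 K}=\begin{bmatrix} \hat K & \hat F & \alpha & O \\ \hat F^\top & \hat G & O & \beta \\ \alpha^\top & O & O & O \\ O & \beta^\top & O & O \end{bmatrix},\qquad \hat{\mathcal M}=\begin{bmatrix} X & Y & O & O \\ Y^\top & O & O & O \\ O & O & O & O \\ O & O & O & O \end{bmatrix}.$$ $\mathrm{Spec}(\mathcal A,\mathcal B)$ denotes the set of eigenvalues, counted with multiplicity, of the linear pencil $\mathcal A-\lambda\mathcal B$: for an $N\times N$ regular pencil these are the roots of $\det(\mathcal A-\lambda\mathcal B)$ with multiplicity, together with $\infty$ with multiplicity $N-\deg_\lambda\det(\mathcal A-\lambda\mathcal B)$. *)

theory Defs
  imports
    "HOL-Analysis.Analysis"
    "HOL-Library.Function_Algebras"
    "HOL-Library.Multiset"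
    "HOL-Computational_Algebra.Polynomial"
    "Jordan_Normal_Form.Matrix"
    "Jordan_Normal_Form.Determinant"
    "Jordan_Normal_Form.Gauss_Jordan_Elimination"
begin

(* The coefficient field uses the fixed-size matrices of HOL-Analysis; the assembled
   finite element matrices have data-dependent sizes and use Jordan_Normal_Form. *)

no_notation Matrix.scalar_prod (infix "\<bullet>" 70)

section \<open>Domain and mesh\<close>

(* The equation Omega = interior (closure Omega) excludes slits; the condition on the
   closure says that it is a finite union of convex polytopes. *)
definition polyhedral_domain :: "'a::euclidean_space set \<Rightarrow> bool" where
  "polyhedral_domain \<Omega> \<longleftrightarrow>
     open \<Omega> \<and> connected \<Omega> \<and> bounded \<Omega> \<and> \<Omega> \<noteq> {} \<and>
     \<Omega> = interior (closure \<Omega>) \<and>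
     (\<exists>\<P>. finite \<P> \<and> (\<forall>Q\<in>\<P>. polytope Q) \<and> closure \<Omega> = \<Union>\<P>)"

definition simplicial_mesh :: "'a::euclidean_space set \<Rightarrow> 'a set set \<Rightarrow> bool" where
  "simplicial_mesh \<Omega> \<T> \<longleftrightarrow>
     triangulation \<T> \<and> (\<forall>T\<in>\<T>. int DIM('a) simplex T) \<and> \<Union>\<T> = closure \<Omega>"

definition mesh_vertices :: "'a::euclidean_space set set \<Rightarrow> 'a set" where
  "mesh_vertices \<T> = {v. \<exists>T\<in>\<T>. v extreme_point_of T}"


section \<open>The coefficients\<close>

(* Extended reals, so that the bounds are meaningful for unbounded A as well. *)
definition kappa_lower :: "(real^'d) set \<Rightarrow> (real^'d \<Rightarrow> real^'d^'d) \<Rightarrow> ereal" where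
  "kappa_lower \<Omega> A = (INF x\<in>\<Omega>. INF \<xi>\<in>{\<xi>. norm \<xi> = 1}. ereal (\<xi> \<bullet> (A x *v \<xi>)))"

definition kappa_upper :: "(real^'d) set \<Rightarrow> (real^'d \<Rightarrow> real^'d^'d) \<Rightarrow> ereal" where
  "kappa_upper \<Omega> A = (SUP x\<in>\<Omega>. SUP \<xi>\<in>{\<xi>. norm \<xi> = 1}. ereal (\<xi> \<bullet> (A x *v \<xi>)))"

definition sym_pos_def :: "real^'d^'d \<Rightarrow> bool" where
  "sym_pos_def B \<longleftrightarrow> Finite_Cartesian_Product.transpose B = B \<and> (\<forall>\<xi>. \<xi> \<noteq> 0 \<longrightarrow> 0 < \<xi> \<bullet> (B *v \<xi>))"


section \<open>Function spaces\<close>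

definition L2_inner :: "'a::euclidean_space set \<Rightarrow> ('a \<Rightarrow> 'b::real_inner) \<Rightarrow> ('a \<Rightarrow> 'b) \<Rightarrow> real" where
  "L2_inner \<Omega> f g = integral\<^sup>L (lebesgue_on \<Omega>) (\<lambda>x. f x \<bullet> g x)"

definition square_integrable :: "'a::euclidean_space set \<Rightarrow> ('a \<Rightarrow> 'b::euclidean_space) \<Rightarrow> bool" where
  "square_integrable \<Omega> f \<longleftrightarrow>
     f \<in> borel_measurable (lebesgue_on \<Omega>) \<and> integrable (lebesgue_on \<Omega>) (\<lambda>x. (norm (f x))\<^sup>2)"

(* Only meaningful where f is differentiable; for a continuous piecewise linear function
   this is almost everywhere, and it is then a representative of the weak gradient. *)
definition grad :: "('a::euclidean_space \<Rightarrow> real) \<Rightarrow> 'a \<Rightarrow> 'a" where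
  "grad f x = (THE D. GDERIV f x :> D)"

coinductive smooth :: "('a::euclidean_space \<Rightarrow> real) \<Rightarrow> bool" where
  "\<lbrakk>\<forall>x. f differentiable (at x); \<forall>v. smooth (\<lambda>x. frechet_derivative f (at x) v)\<rbrakk> \<Longrightarrow> smooth f"

definition test_functions :: "'a::euclidean_space set \<Rightarrow> ('a \<Rightarrow> real) set" where
  "test_functions \<Omega> =
     {\<psi>. smooth \<psi> \<and> compact (closure {x. \<psi> x \<noteq> 0}) \<and> closure {x. \<psi> x \<noteq> 0} \<subseteq> \<Omega>}"

definition weak_gradient ::
  "'a::euclidean_space set \<Rightarrow> ('a \<Rightarrow> real) \<Rightarrow> ('a \<Rightarrow> 'a) \<Rightarrow> bool" where
  "weak_gradient \<Omega> u g \<longleftrightarrow>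
     (\<forall>\<psi>\<in>test_functions \<Omega>.
        integral\<^sup>L (lebesgue_on \<Omega>) (\<lambda>x. u x *\<^sub>R grad \<psi> x)
        = - integral\<^sup>L (lebesgue_on \<Omega>) (\<lambda>x. \<psi> x *\<^sub>R g x))"

(* Closure of the test functions in the H^1 norm. *)
definition H10 :: "'a::euclidean_space set \<Rightarrow> ('a \<Rightarrow> real) set" where
  "H10 \<Omega> =
     {u. \<exists>g. square_integrable \<Omega> u \<and> square_integrable \<Omega> g \<and> weak_gradient \<Omega> u g \<and>
        (\<forall>\<epsilon>>0. \<exists>\<psi>\<in>test_functions \<Omega>.
           L2_inner \<Omega> (\<lambda>x. u x - \<psi> x) (\<lambda>x. u x - \<psi> x)
           + L2_inner \<Omega> (\<lambda>x. g x - grad \<psi> x) (\<lambda>x. g x - grad \<psi> x) < \<epsilon>)}"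

(* A function on the closed domain is represented by its extension by zero, so that
   equality of representatives is equality of functions. *)
definition pw_linear :: "'a::euclidean_space set \<Rightarrow> 'a set set \<Rightarrow> ('a \<Rightarrow> real) set" where
  "pw_linear \<Omega> \<T> =
     {v. continuous_on (closure \<Omega>) v \<and>
         (\<forall>T\<in>\<T>. \<exists>a c. \<forall>x\<in>T. v x = a \<bullet> x + c) \<and>
         (\<forall>x. x \<notin> closure \<Omega> \<longrightarrow> v x = 0)}"

definition pw_linear0 :: "'a::euclidean_space set \<Rightarrow> 'a set set \<Rightarrow> ('a \<Rightarrow> real) set" where
  "pw_linear0 \<Omega> \<T> = pw_linear \<Omega> \<T> \<inter> H10 \<Omega>"

(* Piecewise constants are determined only up to null sets; the representative that is
   zero off the open elements makes the dimension the correct one. *)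
definition pw_constant :: "'a::euclidean_space set set \<Rightarrow> ('a \<Rightarrow> 'a) set" where
  "pw_constant \<T> =
     {w. (\<forall>T\<in>\<T>. \<exists>c. \<forall>x\<in>interior T. w x = c) \<and>
         (\<forall>x. x \<notin> (\<Union>T\<in>\<T>. interior T) \<longrightarrow> w x = 0)}"

global_interpretation fun_space:
  vector_space "\<lambda>(c::real) (f::'a \<Rightarrow> 'b::real_vector) x. c *\<^sub>R f x"
  by unfold_locales (auto simp: fun_eq_iff algebra_simps)

(* Families are indexed from 0: b 0, ..., b (n - 1). *)
definition is_basis :: "nat \<Rightarrow> (nat \<Rightarrow> 'a \<Rightarrow> 'b::real_vector) \<Rightarrow> ('a \<Rightarrow> 'b) set \<Rightarrow> bool" where
  "is_basis n b V \<longleftrightarrow>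
     inj_on b {..<n} \<and> fun_space.independent (b ` {..<n}) \<and> fun_space.span (b ` {..<n}) = V"

definition nodal_basis ::
  "'a::euclidean_space set \<Rightarrow> 'a set set \<Rightarrow> nat \<Rightarrow> (nat \<Rightarrow> 'a \<Rightarrow> real) \<Rightarrow> bool" where
  "nodal_basis \<Omega> \<T> n \<phi> \<longleftrightarrow>
     is_basis n \<phi> (pw_linear \<Omega> \<T>) \<and>
     (\<exists>p. bij_betw p {..<n} (mesh_vertices \<T>) \<and>
          (\<forall>i<n. \<forall>j<n. \<phi> i (p j) = (if i = j then 1 else 0)))"


section \<open>Block matrices\<close>

definition append_cols :: "'a::zero mat \<Rightarrow> 'a mat \<Rightarrow> 'a mat" where
  "append_cols A B = four_block_mat A B (0\<^sub>m 0 (dim_col A)) (0\<^sub>m 0 (dim_col B))"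

fun block_row :: "'a::zero mat list \<Rightarrow> 'a mat" where
  "block_row [] = 0\<^sub>m 0 0"
| "block_row [A] = A"
| "block_row (A # B # Bs) = append_cols A (block_row (B # Bs))"

fun block_col :: "'a::zero mat list \<Rightarrow> 'a mat" where
  "block_col [] = 0\<^sub>m 0 0"
| "block_col [A] = A"
| "block_col (A # B # Bs) = append_rows A (block_col (B # Bs))"

definition block_mat :: "'a::zero mat list list \<Rightarrow> 'a mat" where
  "block_mat Bss = block_col (map block_row Bss)"


section \<open>Matrix pencils\<close>

datatype eigenvalue = Finite complex | Infinite

definition pencil_poly :: "complex mat \<Rightarrow> complex mat \<Rightarrow> complex poly" where
  "pencil_poly A B =
     Determinant.det (map_mat (\<lambda>a. [:a:]) A - [:0, 1:] \<cdot>\<^sub>m map_mat (\<lambda>b. [:b:]) B)"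

definition regular_pencil :: "complex mat \<Rightarrow> complex mat \<Rightarrow> bool" where
  "regular_pencil A B \<longleftrightarrow>
     square_mat A \<and> B \<in> carrier_mat (dim_row A) (dim_row A) \<and> pencil_poly A B \<noteq> 0"

(* Only meaningful for regular pencils. *)
definition pencil_spec :: "complex mat \<Rightarrow> complex mat \<Rightarrow> eigenvalue multiset" where
  "pencil_spec A B =
     image_mset Finite (proots (pencil_poly A B))
     + replicate_mset (dim_row A - degree (pencil_poly A B)) Infinite"

definition pencil_eigenvalue :: "complex mat \<Rightarrow> complex mat \<Rightarrow> complex \<Rightarrow> bool" where
  "pencil_eigenvalue A B \<mu> \<longleftrightarrow>
     (\<exists>z\<in>carrier_vec (dim_col A). z \<noteq> 0\<^sub>v (dim_col A) \<and> A *\<^sub>v z = \<mu> \<cdot>\<^sub>v (B *\<^sub>v z))"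


section \<open>The finite element matrices\<close>

locale fem_matrices =
  fixes \<Omega> :: "(real^'d) set"
    and A :: "real^'d \<Rightarrow> real^'d^'d"
    and \<phi> :: "nat \<Rightarrow> real^'d \<Rightarrow> real"
    and chi :: "nat \<Rightarrow> real^'d \<Rightarrow> real^'d"
    and ne0 nt ne :: nat
begin

definition P :: "real^'d \<Rightarrow> real^'d^'d" where
  "P x = matrix_inv (matrix_inv (A x) - Finite_Cartesian_Product.mat 1)"

definition K_P :: "real mat" where
  "K_P = Matrix.mat ne0 ne0 (\<lambda>(i, j). L2_inner \<Omega> (\<lambda>x. P x *v grad (\<phi> j) x) (grad (\<phi> i)))"

definition F_P :: "real mat" where
  "F_P = Matrix.mat ne0 nt (\<lambda>(i, j). L2_inner \<Omega> (\<lambda>x. P x *v chi j x) (grad (\<phi> i)))"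

definition M_P :: "real mat" where
  "M_P = Matrix.mat nt nt
     (\<lambda>(i, j). L2_inner \<Omega> (\<lambda>x. (Finite_Cartesian_Product.mat 1 + P x) *v chi j x) (chi i))"

definition G :: "real mat" where
  "G = Matrix.mat nt ne (\<lambda>(i, j). L2_inner \<Omega> (grad (\<phi> j)) (chi i))"

definition X :: "real mat" where
  "X = Matrix.mat ne0 ne0 (\<lambda>(i, j). L2_inner \<Omega> (\<phi> j) (\<phi> i))"

definition Y :: "real mat" where
  "Y = Matrix.mat ne0 ne (\<lambda>(i, j). L2_inner \<Omega> (\<phi> j) (\<phi> i))"

definition \<alpha> :: "real mat" where
  "\<alpha> = Matrix.mat ne0 1 (\<lambda>(i, _). L2_inner \<Omega> (\<phi> i) (\<lambda>_. 1))"

definition \<beta> :: "real mat" where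
  "\<beta> = Matrix.mat ne 1 (\<lambda>(i, _). L2_inner \<Omega> (\<phi> i) (\<lambda>_. 1))"

definition M_P_inv :: "real mat" where
  "M_P_inv = the (mat_inverse M_P)"

definition K_hat :: "real mat" where
  "K_hat = K_P - F_P * M_P_inv * transpose_mat F_P"

definition F_hat :: "real mat" where
  "F_hat = F_P * M_P_inv * G"

definition G_hat :: "real mat" where
  "G_hat = - (transpose_mat G * M_P_inv * G)"

definition cal_K :: "real mat" where
  "cal_K = block_mat
    [[K_P,               F_P,               0\<^sub>m ne0 ne,        \<alpha>,         0\<^sub>m ne0 1],
     [transpose_mat F_P, M_P,               - G,               0\<^sub>m nt 1,  0\<^sub>m nt 1 ],
     [0\<^sub>m ne ne0,         - transpose_mat G, 0\<^sub>m ne ne,         0\<^sub>m ne 1,  \<beta>        ],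
     [transpose_mat \<alpha>,   0\<^sub>m 1 nt,           0\<^sub>m 1 ne,          0\<^sub>m 1 1,   0\<^sub>m 1 1  ],
     [0\<^sub>m 1 ne0,          0\<^sub>m 1 nt,           transpose_mat \<beta>,   0\<^sub>m 1 1,   0\<^sub>m 1 1  ]]"

definition cal_M :: "real mat" where
  "cal_M = block_mat
    [[X,               0\<^sub>m ne0 nt, Y,         0\<^sub>m ne0 1, 0\<^sub>m ne0 1],
     [0\<^sub>m nt ne0,       0\<^sub>m nt nt,  0\<^sub>m nt ne,  0\<^sub>m nt 1,  0\<^sub>m nt 1 ],
     [transpose_mat Y, 0\<^sub>m ne nt,  0\<^sub>m ne ne,  0\<^sub>m ne 1,  0\<^sub>m ne 1 ],
     [0\<^sub>m 1 ne0,        0\<^sub>m 1 nt,   0\<^sub>m 1 ne,   0\<^sub>m 1 1,   0\<^sub>m 1 1  ],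
     [0\<^sub>m 1 ne0,        0\<^sub>m 1 nt,   0\<^sub>m 1 ne,   0\<^sub>m 1 1,   0\<^sub>m 1 1  ]]"

definition cal_K_hat :: "real mat" where
  "cal_K_hat = block_mat
    [[K_hat,               F_hat,           \<alpha>,        0\<^sub>m ne0 1],
     [transpose_mat F_hat, G_hat,           0\<^sub>m ne 1, \<beta>        ],
     [transpose_mat \<alpha>,     0\<^sub>m 1 ne,        0\<^sub>m 1 1,  0\<^sub>m 1 1  ],
     [0\<^sub>m 1 ne0,            transpose_mat \<beta>, 0\<^sub>m 1 1,  0\<^sub>m 1 1  ]]"

definition cal_M_hat :: "real mat" where
  "cal_M_hat = block_mat
    [[X,               Y,        0\<^sub>m ne0 1, 0\<^sub>m ne0 1],
     [transpose_mat Y, 0\<^sub>m ne ne, 0\<^sub>m ne 1,  0\<^sub>m ne 1 ],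
     [0\<^sub>m 1 ne0,        0\<^sub>m 1 ne,  0\<^sub>m 1 1,   0\<^sub>m 1 1  ],
     [0\<^sub>m 1 ne0,        0\<^sub>m 1 ne,  0\<^sub>m 1 1,   0\<^sub>m 1 1  ]]"

end

end

theory Submission
  imports Defs
begin

text \<open>
  Eliminating the second block row and column (the one of \<open>M_P\<close>) is an equivalence transformation
  \<open>L (K - \<lambda> M) Q\<close> with constant nonsingular \<open>L\<close>, \<open>Q\<close>, since \<open>M\<close> vanishes in that block; the result is
  block triangular with diagonal blocks \<open>M_P\<close> and \<open>K' - \<lambda> M'\<close>. Hence the two characteristic
  polynomials differ by a nonzero constant factor and only the sizes of the pencils differ.

  Regularity holds because \<open>K\<close> itself is nonsingular. In a kernel vector \<open>(u, p, w, s, t)\<close>, testing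
  the third equation with the constant function gives \<open>t = 0\<close>; testing the first three with \<open>u, p, w\<close>
  gives \<open>(P (\<nabla>u + p), \<nabla>u + p) + (p, p) = 0\<close>, so \<open>p = 0\<close> and \<open>\<nabla>u = 0\<close>, since \<open>0 < A < I\<close> makes \<open>P\<close>
  positive definite. A piecewise linear function with zero gradient takes finitely many values on a
  connected set, so it is constant, and it vanishes because its mean does; this applies to \<open>u\<close> and
  then to \<open>w\<close>. Finally \<open>s = 0\<close> because nodal basis functions have positive integral.
\<close>

subsection \<open>Matrix pencils\<close>

lemma dim_append_cols [simp]:
  "dim_row (append_cols A B) = dim_row A" "dim_col (append_cols A B) = dim_col A + dim_col B"
  by (simp_all add: append_cols_def)

lemma dim_append_rows [simp]:
  "dim_row (append_rows A B) = dim_row A + dim_row B" "dim_col (append_rows A B) = dim_col A"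
  by (simp_all add: append_rows_def)

text \<open>\<open>append_cols\<close> is a \<open>four_block_mat\<close> whose lower blocks have no
  rows, so the product carries a tail of length 0, which \<open>eq_vecI\<close> discards.\<close>

lemma append_cols_mult_append_vec:
  fixes A :: "'a::comm_ring_1 mat"
  assumes "dim_row B = dim_row A" "dim_col A = dim_vec x" "dim_col B = dim_vec y"
  shows "append_cols A B *\<^sub>v (x @\<^sub>v y) = A *\<^sub>v x + B *\<^sub>v y"
proof -
  have "append_cols A B *\<^sub>v (x @\<^sub>v y)
      = (A *\<^sub>v x + B *\<^sub>v y) @\<^sub>v (0\<^sub>m 0 (dim_col A) *\<^sub>v x + 0\<^sub>m 0 (dim_col B) *\<^sub>v y)"
    unfolding append_cols_def
    by (rule four_block_mat_mult_vec[where ?nr1.0 = "dim_row A" and ?nc1.0 = "dim_col A"])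
       (use assms in \<open>auto intro: carrier_matI carrier_vecI\<close>)
  then show ?thesis
    using assms by (intro eq_vecI) auto
qed

lemma append_rows_mult_vec:
  fixes A :: "'a::comm_ring_1 mat"
  assumes "dim_col A = dim_vec x" "dim_col B = dim_vec x"
  shows "append_rows A B *\<^sub>v x = (A *\<^sub>v x) @\<^sub>v (B *\<^sub>v x)"
  by (rule mat_mult_append[of _ "dim_row A" "dim_vec x" _ "dim_row B"])
     (use assms in \<open>auto intro: carrier_matI carrier_vecI\<close>)

lemmas block_mat_simps =
  block_mat_def append_cols_mult_append_vec append_rows_mult_vec

lemma mat_eqI_mult_vec:
  fixes A :: "'a::comm_ring_1 mat"
  assumes "A \<in> carrier_mat n m" "B \<in> carrier_mat n m"
    and "\<And>v. v \<in> carrier_vec m \<Longrightarrow> A *\<^sub>v v = B *\<^sub>v v"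
  shows "A = B"
proof (rule eq_matI)
  fix i j assume "i < dim_row B" "j < dim_col B"
  with assms have ij: "i < n" "j < m" by auto
  have "(A *\<^sub>v unit_vec m j) $ i = A $$ (i, j)" "(B *\<^sub>v unit_vec m j) $ i = B $$ (i, j)"
    using assms(1,2) ij by auto
  then show "A $$ (i, j) = B $$ (i, j)"
    by (simp add: assms(3))
qed (use assms in auto)

section \<open>Characteristic polynomial and spectrum of a pencil\<close>

lemma poly_pencil_poly:
  assumes "A \<in> carrier_mat n n" "B \<in> carrier_mat n n"
  shows "poly (pencil_poly A B) \<mu> = Determinant.det (A - \<mu> \<cdot>\<^sub>m B)"
proof -
  \<comment> \<open>Evaluation at \<mu> is a ring homomorphism and therefore commutes with the
    determinant.\<close>
  interpret ev: comm_ring_hom "\<lambda>p. poly p \<mu>"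
    by unfold_locales auto
  have "poly (pencil_poly A B) \<mu>
      = Determinant.det (map_mat (\<lambda>p. poly p \<mu>) (map_mat (\<lambda>a. [:a:]) A - [:0, 1:] \<cdot>\<^sub>m map_mat (\<lambda>b. [:b:]) B))"
    by (simp add: pencil_poly_def)
  also have "map_mat (\<lambda>p. poly p \<mu>) (map_mat (\<lambda>a. [:a:]) A - [:0, 1:] \<cdot>\<^sub>m map_mat (\<lambda>b. [:b:]) B)
      = A - \<mu> \<cdot>\<^sub>m B"
    using assms by (intro eq_matI) auto
  finally show ?thesis .
qed

text \<open>All entries have degree at most 1. The bound makes
  \<open>dim_row A - degree (pencil_poly A B)\<close> in \<open>pencil_spec\<close> a genuine
  difference rather than a truncated one.\<close>

lemma degree_pencil_poly_le:
  assumes "A \<in> carrier_mat n n" "B \<in> carrier_mat n n"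
  shows "degree (pencil_poly A B) \<le> n"
proof -
  have "degree (pencil_poly A B) \<le> 1 * n"
    unfolding pencil_poly_def
    by (rule degree_det_le)
       (use assms in \<open>auto intro!: degree_diff_le\<close>)
  then show ?thesis by simp
qed

lemma pencil_eigenvalue_iff:
  assumes A: "A \<in> carrier_mat n n" and B: "B \<in> carrier_mat n n"
  shows "pencil_eigenvalue A B \<mu> \<longleftrightarrow> poly (pencil_poly A B) \<mu> = 0"
proof -
  have C: "A - \<mu> \<cdot>\<^sub>m B \<in> carrier_mat n n" using A B by auto
  have "(A - \<mu> \<cdot>\<^sub>m B) *\<^sub>v z = 0\<^sub>v n \<longleftrightarrow> A *\<^sub>v z = \<mu> \<cdot>\<^sub>v (B *\<^sub>v z)" if "z \<in> carrier_vec n" for z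
  proof -
    have "(A - \<mu> \<cdot>\<^sub>m B) *\<^sub>v z = A *\<^sub>v z - \<mu> \<cdot>\<^sub>v (B *\<^sub>v z)"
      using A B that
      by (intro eq_vecI) (auto simp: scalar_prod_def algebra_simps sum_subtractf sum_distrib_left)
    moreover have "x - y = 0\<^sub>v n \<longleftrightarrow> x = y"
      if "x \<in> carrier_vec n" "y \<in> carrier_vec n" for x y :: "complex vec"
      using that by (auto simp: vec_eq_iff)
    ultimately show ?thesis using A B that by auto
  qed
  then show ?thesis
    using A unfolding poly_pencil_poly[OF A B] det_0_iff_vec_prod_zero_field[OF C] pencil_eigenvalue_def
    by auto
qed

text \<open>Proportional polynomials have the same roots with multiplicities and the same degree, so
  the spectra can differ only in the copies of \<open>Infinite\<close>, and the sizes differ by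
  \<open>n\<close>. Regularity follows because \<open>Determinant.det K\<close> is the value of the
  first polynomial at 0.\<close>

lemma pencil_spec_reduction:
  assumes K: "K \<in> carrier_mat (n + m) (n + m)" and M: "M \<in> carrier_mat (n + m) (n + m)"
    and K': "K' \<in> carrier_mat m m" and M': "M' \<in> carrier_mat m m"
    and c: "c \<noteq> 0" and pp: "pencil_poly K M = Polynomial.smult c (pencil_poly K' M')"
    and det: "Determinant.det K \<noteq> 0"
  shows "regular_pencil K M \<and> regular_pencil K' M' \<and>
        (\<forall>\<mu>. pencil_eigenvalue K M \<mu> \<longleftrightarrow> pencil_eigenvalue K' M' \<mu>) \<and>
        replicate_mset n Infinite \<subseteq># pencil_spec K M \<and>
        pencil_spec K' M' = pencil_spec K M - replicate_mset n Infinite"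
proof -
  have "K - 0 \<cdot>\<^sub>m M = K"
    using K M by auto
  then have "poly (pencil_poly K M) 0 \<noteq> 0"
    using det by (simp add: poly_pencil_poly[OF K M])
  then have nz: "pencil_poly K M \<noteq> 0" by auto
  then have nz': "pencil_poly K' M' \<noteq> 0" using pp by auto
  have "degree (pencil_poly K' M') \<le> m"
    by (rule degree_pencil_poly_le[OF K' M'])
  \<comment> \<open>Subtraction of natural numbers: moving \<open>n\<close> out of the difference
    needs the degree bound of the smaller pencil.\<close>
  then have deg: "n + m - degree (pencil_poly K' M') = n + (m - degree (pencil_poly K' M'))" by simp
  have spec: "pencil_spec K M = pencil_spec K' M' + replicate_mset n Infinite"
    using K K' c deg unfolding pencil_spec_def pp
    by (intro multiset_eqI) simp
  show ?thesis
    using nz nz' K M K' M' c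
    by (auto simp: regular_pencil_def spec pencil_eigenvalue_iff[OF K M] pencil_eigenvalue_iff[OF K' M'] pp)
qed

lemma det_nonzeroI:
  assumes "A \<in> carrier_mat n n" "\<And>v. v \<in> carrier_vec n \<Longrightarrow> A *\<^sub>v v = 0\<^sub>v n \<Longrightarrow> v = 0\<^sub>v n"
  shows "Determinant.det (A :: 'a::field mat) \<noteq> 0"
  using assms det_0_iff_vec_prod_zero_field[OF assms(1)] by auto

text \<open>For each fixed \<mu> the transformed pencil is block lower triangular with the constant
  block \<open>D\<close>, because the image of \<open>M\<close> lives in the last diagonal block
  only. Comparing determinants yields the factor.\<close>

lemma pencil_poly_block_triangular:
  fixes K M L Q :: "complex mat"
  assumes K: "K \<in> carrier_mat (n + m) (n + m)" and M: "M \<in> carrier_mat (n + m) (n + m)"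
    and L: "L \<in> carrier_mat (n + m) (n + m)" and Q: "Q \<in> carrier_mat (n + m) (n + m)"
    and K': "K' \<in> carrier_mat m m" and M': "M' \<in> carrier_mat m m"
    and D: "D \<in> carrier_mat n n" and C: "C \<in> carrier_mat m n"
    and LKQ: "L * K * Q = four_block_mat D (0\<^sub>m n m) C K'"
    and LMQ: "L * M * Q = four_block_mat (0\<^sub>m n n) (0\<^sub>m n m) (0\<^sub>m m n) M'"
    and det: "Determinant.det L \<noteq> 0" "Determinant.det Q \<noteq> 0"
  shows "pencil_poly K M
    = Polynomial.smult (Determinant.det D / (Determinant.det L * Determinant.det Q)) (pencil_poly K' M')"
proof -
  have "poly (pencil_poly K M) \<mu>
      = Determinant.det D / (Determinant.det L * Determinant.det Q) * poly (pencil_poly K' M') \<mu>" for \<mu>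
  proof -
    have "L * (K - \<mu> \<cdot>\<^sub>m M) * Q = L * K * Q - \<mu> \<cdot>\<^sub>m (L * M * Q)"
      using K M L Q
      by (simp add: mult_minus_distrib_mat[of _ "n+m" "n+m"] minus_mult_distrib_mat[of _ "n+m" "n+m"]
          mult_smult_distrib[of _ "n+m" "n+m"] mult_smult_assoc_mat[of _ "n+m" "n+m"])
    also have "\<dots> = four_block_mat D (0\<^sub>m n m) C (K' - \<mu> \<cdot>\<^sub>m M')"
      using D C K' M' unfolding LKQ LMQ by (intro eq_matI) auto
    finally have "Determinant.det (L * (K - \<mu> \<cdot>\<^sub>m M) * Q)
        = Determinant.det D * Determinant.det (K' - \<mu> \<cdot>\<^sub>m M')"
      using D C K' M' by (subst det_four_block_mat_upper_right_zero[of D n _ m, symmetric]) auto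
    moreover have "Determinant.det (L * (K - \<mu> \<cdot>\<^sub>m M) * Q)
        = Determinant.det L * Determinant.det (K - \<mu> \<cdot>\<^sub>m M) * Determinant.det Q"
      by (subst det_mult[of _ "n + m"], insert K M L Q, simp_all only: det_mult[of L "n + m"] minus_carrier_mat smult_carrier_mat mult_carrier_mat)
    ultimately show ?thesis
      using det by (simp add: poly_pencil_poly[OF K M] poly_pencil_poly[OF K' M'] field_simps)
  qed
  \<comment> \<open>Polynomials that agree at every complex number are equal.\<close>
  then show ?thesis
    by (intro poly_eq_poly_eq_iff[THEN iffD1]) (auto simp: fun_eq_iff)
qed

subsection \<open>Block elimination\<close>

lemma append_vec_zero [simp]: "0\<^sub>v n @\<^sub>v 0\<^sub>v m = 0\<^sub>v (n + m)"
  by (intro eq_vecI) auto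

lemma zero_mat_mult_vec [simp]:
  fixes v :: "'a::comm_ring_1 vec"
  shows "dim_vec v = m \<Longrightarrow> 0\<^sub>m n m *\<^sub>v v = 0\<^sub>v n"
  by (intro eq_vecI) auto

lemma add_zero_vec [simp]:
  fixes v :: "'a::monoid_add vec"
  shows "dim_vec v = n \<Longrightarrow> v + 0\<^sub>v n = v" "dim_vec v = n \<Longrightarrow> 0\<^sub>v n + v = v"
  by (intro eq_vecI; simp)+

lemma one_mat_mult_vec [simp]:
  fixes v :: "'a::comm_ring_1 vec"
  shows "dim_vec v = n \<Longrightarrow> 1\<^sub>m n *\<^sub>v v = v"
  by (rule one_mult_mat_vec) (auto intro: carrier_vecI)

lemma append_vec_cases:
  assumes "dim_vec v = n + m"
  obtains x y where "v = x @\<^sub>v y" "dim_vec x = n" "dim_vec y = m"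
proof (rule that[of "vec_first v n" "vec_last v m"])
  show "v = vec_first v n @\<^sub>v vec_last v m"
    using assms by (subst vec_first_last_append) (auto intro: carrier_vecI)
qed auto

lemma append_vec_eq_zero_iff:
  assumes "dim_vec x = n" "dim_vec y = m"
  shows "x @\<^sub>v y = 0\<^sub>v (n + m) \<longleftrightarrow> x = 0\<^sub>v n \<and> y = 0\<^sub>v m"
proof -
  have "x @\<^sub>v y = 0\<^sub>v n @\<^sub>v 0\<^sub>v m \<longleftrightarrow> x = 0\<^sub>v n \<and> y = 0\<^sub>v m"
    by (rule append_vec_eq[of x n]) (use assms in \<open>auto intro: carrier_vecI\<close>)
  then show ?thesis by simp
qed

text \<open>Dimensions are stated as equations of \<open>dim_col\<close> and \<open>dim_vec\<close>
  instead of carrier membership, so that rewriting can discharge them inside nested blocks.\<close>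

lemma mult_mat_vec_assoc:
  fixes v :: "'a::comm_ring_1 vec"
  assumes "dim_col A = dim_row B" "dim_col B = dim_vec v"
  shows "(A * B) *\<^sub>v v = A *\<^sub>v (B *\<^sub>v v)"
  by (rule assoc_mult_mat_vec) (use assms in \<open>auto intro: carrier_matI carrier_vecI\<close>)

lemma mult_mat_vec_add:
  fixes v :: "'a::comm_ring_1 vec"
  assumes "dim_col A = dim_vec v" "dim_vec w = dim_vec v"
  shows "A *\<^sub>v (v + w) = A *\<^sub>v v + A *\<^sub>v w"
  by (rule mult_add_distrib_mat_vec) (use assms in \<open>auto intro: carrier_matI carrier_vecI\<close>)

lemma mult_mat_vec_uminus:
  fixes v :: "'a::comm_ring_1 vec"
  assumes "dim_col A = dim_vec v"
  shows "A *\<^sub>v (- v) = - (A *\<^sub>v v)"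
  using assms by (intro eq_vecI) auto

lemma uminus_mat_mult_vec:
  fixes v :: "'a::comm_ring_1 vec"
  assumes "dim_col A = dim_vec v"
  shows "(- A) *\<^sub>v v = - (A *\<^sub>v v)"
  using assms by (intro eq_vecI) auto

lemma minus_mat_mult_vec:
  fixes v :: "'a::comm_ring_1 vec"
  assumes "dim_col A = dim_vec v" "dim_col B = dim_vec v" "dim_row B = dim_row A"
  shows "(A - B) *\<^sub>v v = A *\<^sub>v v - B *\<^sub>v v"
  by (rule minus_mult_distrib_mat_vec) (use assms in \<open>auto intro: carrier_matI carrier_vecI\<close>)

lemmas mult_mat_vec_distribs =
  mult_mat_vec_assoc mult_mat_vec_add mult_mat_vec_uminus uminus_mat_mult_vec minus_mat_mult_vec

lemma four_block_mat_mult_append_vec: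
  fixes A :: "'a::comm_ring_1 mat"
  assumes "dim_col B = dim_vec y" "dim_col C = dim_vec x" "dim_col A = dim_vec x" "dim_col D = dim_vec y"
    "dim_row B = dim_row A" "dim_row D = dim_row C"
  shows "four_block_mat A B C D *\<^sub>v (x @\<^sub>v y) = (A *\<^sub>v x + B *\<^sub>v y) @\<^sub>v (C *\<^sub>v x + D *\<^sub>v y)"
  by (rule four_block_mat_mult_vec) (use assms in \<open>auto intro: carrier_matI carrier_vecI\<close>)

lemma mult_mat_zero_vec:
  "dim_col A = n \<Longrightarrow> A *\<^sub>v 0\<^sub>v n = (0\<^sub>v (dim_row A) :: 'a::comm_ring_1 vec)"
  by (intro eq_vecI) auto

lemma append_vec_eq_zero_iff5:
  assumes "dim_vec x1 = n1" "dim_vec x2 = n2" "dim_vec x3 = n3" "dim_vec x4 = n4" "dim_vec x5 = n5"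
  shows "x1 @\<^sub>v x2 @\<^sub>v x3 @\<^sub>v x4 @\<^sub>v x5 = 0\<^sub>v (n1 + (n2 + (n3 + (n4 + n5)))) \<longleftrightarrow>
    x1 = 0\<^sub>v n1 \<and> x2 = 0\<^sub>v n2 \<and> x3 = 0\<^sub>v n3 \<and> x4 = 0\<^sub>v n4 \<and> x5 = 0\<^sub>v n5"
  using assms by (simp add: append_vec_eq_zero_iff)

lemma append_vec_cong: "x = x' \<Longrightarrow> y = y' \<Longrightarrow> x @\<^sub>v y = x' @\<^sub>v y'"
  by simp

lemma append_vec_plus_append_vec:
  assumes "dim_vec x' = dim_vec x" "dim_vec y' = dim_vec y"
  shows "(x @\<^sub>v y) + (x' @\<^sub>v y') = (x + x') @\<^sub>v (y + y')"
  by (rule append_vec_add) (use assms in \<open>auto intro: carrier_vecI\<close>)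

section \<open>Elimination of one block from an abstract five-block pencil\<close>

locale block_elimination =
  fixes n m e :: nat and K F M Mi G X Y a b :: "'a::field mat"
  assumes dims [simp]:
      "dim_row K = n" "dim_col K = n" "dim_row F = n" "dim_col F = m"
      "dim_row M = m" "dim_col M = m" "dim_row Mi = m" "dim_col Mi = m"
      "dim_row G = m" "dim_col G = e" "dim_row X = n" "dim_col X = n"
      "dim_row Y = n" "dim_col Y = e" "dim_row a = n" "dim_col a = 1"
      "dim_row b = e" "dim_col b = 1"
    and inv: "M * Mi = 1\<^sub>m m" and sym: "transpose_mat Mi = Mi"
begin

text \<open>The block permutation that brings the second block row to the top.\<close>

definition left_mult :: "'a mat" where "left_mult = block_mat
    [[0\<^sub>m m n, 1\<^sub>m m,   0\<^sub>m m e, 0\<^sub>m m 1, 0\<^sub>m m 1],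
     [1\<^sub>m n,   0\<^sub>m n m, 0\<^sub>m n e, 0\<^sub>m n 1, 0\<^sub>m n 1],
     [0\<^sub>m e n, 0\<^sub>m e m, 1\<^sub>m e,   0\<^sub>m e 1, 0\<^sub>m e 1],
     [0\<^sub>m 1 n, 0\<^sub>m 1 m, 0\<^sub>m 1 e, 1\<^sub>m 1,   0\<^sub>m 1 1],
     [0\<^sub>m 1 n, 0\<^sub>m 1 m, 0\<^sub>m 1 e, 0\<^sub>m 1 1, 1\<^sub>m 1]]"

text \<open>Takes \<open>p\<close> in first place and returns it in second place, shifted by the
  solution of the second block row for given \<open>u\<close> and \<open>w\<close>. The shift
  cancels \<open>u\<close> and \<open>w\<close> from that row, so that only
  \<open>M *\<^sub>v p\<close> is left there.\<close>

definition "right_mult = block_mat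
    [[0\<^sub>m n m, 1\<^sub>m n,                       0\<^sub>m n e, 0\<^sub>m n 1, 0\<^sub>m n 1],
     [1\<^sub>m m,   - (Mi * transpose_mat F), Mi * G, 0\<^sub>m m 1, 0\<^sub>m m 1],
     [0\<^sub>m e m, 0\<^sub>m e n,                     1\<^sub>m e,   0\<^sub>m e 1, 0\<^sub>m e 1],
     [0\<^sub>m 1 m, 0\<^sub>m 1 n,                     0\<^sub>m 1 e, 1\<^sub>m 1,   0\<^sub>m 1 1],
     [0\<^sub>m 1 m, 0\<^sub>m 1 n,                     0\<^sub>m 1 e, 0\<^sub>m 1 1, 1\<^sub>m 1]]"

definition "cK = block_mat
    [[K,               F,                 0\<^sub>m n e,           a,         0\<^sub>m n 1],
     [transpose_mat F, M,                 - G,               0\<^sub>m m 1,  0\<^sub>m m 1 ],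
     [0\<^sub>m e n,         - transpose_mat G, 0\<^sub>m e e,         0\<^sub>m e 1,  b        ],
     [transpose_mat a, 0\<^sub>m 1 m,           0\<^sub>m 1 e,          0\<^sub>m 1 1,   0\<^sub>m 1 1  ],
     [0\<^sub>m 1 n,          0\<^sub>m 1 m,           transpose_mat b,   0\<^sub>m 1 1,   0\<^sub>m 1 1  ]]"

definition "cM = block_mat
    [[X,               0\<^sub>m n m, Y,         0\<^sub>m n 1, 0\<^sub>m n 1],
     [0\<^sub>m m n,       0\<^sub>m m m,  0\<^sub>m m e,  0\<^sub>m m 1,  0\<^sub>m m 1 ],
     [transpose_mat Y, 0\<^sub>m e m,  0\<^sub>m e e,  0\<^sub>m e 1,  0\<^sub>m e 1 ],
     [0\<^sub>m 1 n,        0\<^sub>m 1 m,   0\<^sub>m 1 e,   0\<^sub>m 1 1,   0\<^sub>m 1 1  ],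
     [0\<^sub>m 1 n,        0\<^sub>m 1 m,   0\<^sub>m 1 e,   0\<^sub>m 1 1,   0\<^sub>m 1 1  ]]"

definition "cK_hat = block_mat
    [[K - F * Mi * transpose_mat F,  F * Mi * G,                       a,        0\<^sub>m n 1],
     [transpose_mat (F * Mi * G),   - (transpose_mat G * Mi * G), 0\<^sub>m e 1, b        ],
     [transpose_mat a,     0\<^sub>m 1 e,        0\<^sub>m 1 1,  0\<^sub>m 1 1  ],
     [0\<^sub>m 1 n,            transpose_mat b, 0\<^sub>m 1 1,  0\<^sub>m 1 1  ]]"

definition "cM_hat = block_mat
    [[X,               Y,        0\<^sub>m n 1, 0\<^sub>m n 1],
     [transpose_mat Y, 0\<^sub>m e e, 0\<^sub>m e 1,  0\<^sub>m e 1 ],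
     [0\<^sub>m 1 n,        0\<^sub>m 1 e,  0\<^sub>m 1 1,   0\<^sub>m 1 1  ],
     [0\<^sub>m 1 n,        0\<^sub>m 1 e,  0\<^sub>m 1 1,   0\<^sub>m 1 1  ]]"

text \<open>The block below \<open>M\<close> in the eliminated matrix: the block column of
  \<open>cK\<close> that multiplies \<open>p\<close>, without its row \<open>M\<close>.\<close>

definition "cC = block_mat [[F], [- transpose_mat G], [0\<^sub>m 1 m], [0\<^sub>m 1 m]]"

text \<open>The sum is nested to the right like the concatenations, so that splitting a vector of
  this length peels off one block at a time.\<close>

definition "N = n + (e + (1 + 1))"

lemma carriers:
  "left_mult \<in> carrier_mat (m + N) (m + N)" "right_mult \<in> carrier_mat (m + N) (m + N)"
  "cK \<in> carrier_mat (m + N) (m + N)" "cM \<in> carrier_mat (m + N) (m + N)"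
  "cK_hat \<in> carrier_mat N N" "cM_hat \<in> carrier_mat N N" "cC \<in> carrier_mat N m"
  by (intro carrier_matI; simp add: left_mult_def right_mult_def cK_def cM_def cK_hat_def cM_hat_def cC_def N_def block_mat_def)+

lemmas carrier_dims [simp] = carriers[THEN carrier_matD(1)] carriers[THEN carrier_matD(2)]

lemma vec_cases:
  assumes "dim_vec v = m + N"
  obtains p u w s t where "v = p @\<^sub>v u @\<^sub>v w @\<^sub>v s @\<^sub>v t"
    "dim_vec p = m" "dim_vec u = n" "dim_vec w = e" "dim_vec s = 1" "dim_vec t = 1"
proof -
  from assms obtain p v1 where v: "v = p @\<^sub>v v1" "dim_vec p = m" "dim_vec v1 = N"
    by (rule append_vec_cases)
  from v(3) obtain u v2 where v1: "v1 = u @\<^sub>v v2" "dim_vec u = n" "dim_vec v2 = e + (1 + 1)"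
    unfolding N_def by (rule append_vec_cases)
  from v1(3) obtain w v3 where v2: "v2 = w @\<^sub>v v3" "dim_vec w = e" "dim_vec v3 = 1 + 1"
    by (rule append_vec_cases)
  from v2(3) obtain s t where v3: "v3 = s @\<^sub>v t" "dim_vec s = 1" "dim_vec t = 1"
    by (rule append_vec_cases)
  show thesis
    by (rule that[of p u w s t]; simp add: v v1 v2 v3)
qed

text \<open>Two orders of the blocks occur: \<open>p\<close> first for the argument of
  \<open>right_mult\<close>, \<open>u\<close> first for the arguments of \<open>cK\<close>,
  \<open>cM\<close> and \<open>left_mult\<close>.\<close>

lemma vec_cases':
  assumes "dim_vec v = m + N"
  obtains u p w s t where "v = u @\<^sub>v p @\<^sub>v w @\<^sub>v s @\<^sub>v t"
    "dim_vec p = m" "dim_vec u = n" "dim_vec w = e" "dim_vec s = 1" "dim_vec t = 1"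
proof -
  from assms have "dim_vec v = n + (m + (e + (1 + 1)))"
    by (simp add: N_def)
  then obtain u v1 where v: "v = u @\<^sub>v v1" "dim_vec u = n" "dim_vec v1 = m + (e + (1 + 1))"
    by (rule append_vec_cases)
  from v(3) obtain p v2 where v1: "v1 = p @\<^sub>v v2" "dim_vec p = m" "dim_vec v2 = e + (1 + 1)"
    by (rule append_vec_cases)
  from v1(3) obtain w v3 where v2: "v2 = w @\<^sub>v v3" "dim_vec w = e" "dim_vec v3 = 1 + 1"
    by (rule append_vec_cases)
  from v2(3) obtain s t where v3: "v3 = s @\<^sub>v t" "dim_vec s = 1" "dim_vec t = 1"
    by (rule append_vec_cases)
  show thesis
    by (rule that[of u p w s t]; simp add: v v1 v2 v3)
qed

lemma left_mult_vec:
  assumes "dim_vec p = m" "dim_vec u = n" "dim_vec w = e" "dim_vec s = 1" "dim_vec t = 1"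
  shows "left_mult *\<^sub>v (u @\<^sub>v p @\<^sub>v w @\<^sub>v s @\<^sub>v t) = p @\<^sub>v u @\<^sub>v w @\<^sub>v s @\<^sub>v t"
  using assms by (simp add: left_mult_def block_mat_simps)

lemma right_mult_vec:
  assumes "dim_vec p = m" "dim_vec u = n" "dim_vec w = e" "dim_vec s = 1" "dim_vec t = 1"
  shows "right_mult *\<^sub>v (p @\<^sub>v u @\<^sub>v w @\<^sub>v s @\<^sub>v t)
    = u @\<^sub>v (p + (- (Mi * transpose_mat F) *\<^sub>v u + (Mi * G) *\<^sub>v w)) @\<^sub>v w @\<^sub>v s @\<^sub>v t"
  using assms by (simp add: right_mult_def block_mat_simps)

lemma cK_mult_vec:
  assumes "dim_vec p = m" "dim_vec u = n" "dim_vec w = e" "dim_vec s = 1" "dim_vec t = 1"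
  shows "cK *\<^sub>v (u @\<^sub>v p @\<^sub>v w @\<^sub>v s @\<^sub>v t)
    = (K *\<^sub>v u + (F *\<^sub>v p + a *\<^sub>v s)) @\<^sub>v (transpose_mat F *\<^sub>v u + (M *\<^sub>v p + - G *\<^sub>v w)) @\<^sub>v
      (- transpose_mat G *\<^sub>v p + b *\<^sub>v t) @\<^sub>v (transpose_mat a *\<^sub>v u) @\<^sub>v (transpose_mat b *\<^sub>v w)"
  using assms by (simp add: cK_def block_mat_simps)

lemma cM_mult_vec:
  assumes "dim_vec p = m" "dim_vec u = n" "dim_vec w = e" "dim_vec s = 1" "dim_vec t = 1"
  shows "cM *\<^sub>v (u @\<^sub>v p @\<^sub>v w @\<^sub>v s @\<^sub>v t)
    = (X *\<^sub>v u + Y *\<^sub>v w) @\<^sub>v 0\<^sub>v m @\<^sub>v (transpose_mat Y *\<^sub>v u) @\<^sub>v 0\<^sub>v 1 @\<^sub>v 0\<^sub>v 1"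
  using assms by (simp add: cM_def block_mat_simps)

lemma cK_hat_mult_vec:
  assumes "dim_vec u = n" "dim_vec w = e" "dim_vec s = 1" "dim_vec t = 1"
  shows "cK_hat *\<^sub>v (u @\<^sub>v w @\<^sub>v s @\<^sub>v t)
    = ((K - F * Mi * transpose_mat F) *\<^sub>v u + (F * Mi * G *\<^sub>v w + a *\<^sub>v s)) @\<^sub>v
      (transpose_mat (F * Mi * G) *\<^sub>v u + (- (transpose_mat G * Mi * G) *\<^sub>v w + b *\<^sub>v t)) @\<^sub>v
      (transpose_mat a *\<^sub>v u) @\<^sub>v (transpose_mat b *\<^sub>v w)"
  using assms by (simp add: cK_hat_def block_mat_simps)

lemma cM_hat_mult_vec:
  assumes "dim_vec u = n" "dim_vec w = e" "dim_vec s = 1" "dim_vec t = 1"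
  shows "cM_hat *\<^sub>v (u @\<^sub>v w @\<^sub>v s @\<^sub>v t)
    = (X *\<^sub>v u + Y *\<^sub>v w) @\<^sub>v (transpose_mat Y *\<^sub>v u) @\<^sub>v 0\<^sub>v 1 @\<^sub>v 0\<^sub>v 1"
  using assms by (simp add: cM_hat_def block_mat_simps)

lemma cC_mult_vec:
  assumes "dim_vec p = m"
  shows "cC *\<^sub>v p = (F *\<^sub>v p) @\<^sub>v (- transpose_mat G *\<^sub>v p) @\<^sub>v 0\<^sub>v 1 @\<^sub>v 0\<^sub>v 1"
  using assms by (simp add: cC_def block_mat_simps)

lemma inv_mult_vec: "dim_vec v = m \<Longrightarrow> M *\<^sub>v (Mi *\<^sub>v v) = v"
  using inv by (simp flip: mult_mat_vec_assoc)

text \<open>The symmetry of \<open>Mi\<close> enters here: it identifies the block produced by the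
  elimination with the transposed block in \<open>cK_hat\<close>.\<close>

lemma transpose_FMiG: "transpose_mat (F * Mi * G) = transpose_mat G * (Mi * transpose_mat F)"
proof -
  have "transpose_mat (F * Mi * G) = transpose_mat G * transpose_mat (F * Mi)"
    by (rule transpose_mult) (auto intro: carrier_matI)
  also have "transpose_mat (F * Mi) = Mi * transpose_mat F"
    using sym by (subst transpose_mult[of _ n m _ m]) (auto intro: carrier_matI)
  finally show ?thesis .
qed

lemma reduce_K:
  "left_mult * cK * right_mult = four_block_mat M (0\<^sub>m m N) cC cK_hat" (is "?l = ?r")
proof (rule mat_eqI_mult_vec)
  show "?l \<in> carrier_mat (m + N) (m + N)"
    by (intro carrier_matI) simp_all
  show "?r \<in> carrier_mat (m + N) (m + N)"
    by (intro carrier_matI) simp_all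
  fix v :: "'a vec" assume "v \<in> carrier_vec (m + N)"
  then have "dim_vec v = m + N" by simp
  then obtain p u w s t where v: "v = p @\<^sub>v u @\<^sub>v w @\<^sub>v s @\<^sub>v t"
    and d: "dim_vec p = m" "dim_vec u = n" "dim_vec w = e" "dim_vec s = 1" "dim_vec t = 1"
    by (rule vec_cases)
  define p' where "p' = p + (- (Mi * transpose_mat F) *\<^sub>v u + (Mi * G) *\<^sub>v w)"
  \<comment> \<open>One scalar identity for each of the first three block rows after the
    permutation: the first is the cancellation that leaves \<open>M *\<^sub>v p\<close>, the other
    two collect the Schur complement terms. The last two rows agree already.\<close>
  have ring_ids: "x + (y + (- x + z) + - z) = y" "k + (q + (- x + z) + y) = q + ((k - x) + (z + y))"
    "- (q + (- x + z)) + y = - q + (x + (- z + y))" for x y z k q :: 'a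
    by (simp_all add: algebra_simps)
  have d': "dim_vec p' = m" using d by (simp add: p'_def)
  have "?l *\<^sub>v v = left_mult *\<^sub>v (cK *\<^sub>v (right_mult *\<^sub>v v))"
    by (subst mult_mat_vec_assoc; use \<open>dim_vec v = m + N\<close> in \<open>simp add: mult_mat_vec_assoc\<close>)
  also have "\<dots> = (transpose_mat F *\<^sub>v u + (M *\<^sub>v p' + - G *\<^sub>v w)) @\<^sub>v
      (K *\<^sub>v u + (F *\<^sub>v p' + a *\<^sub>v s)) @\<^sub>v
      (- transpose_mat G *\<^sub>v p' + b *\<^sub>v t) @\<^sub>v (transpose_mat a *\<^sub>v u) @\<^sub>v (transpose_mat b *\<^sub>v w)"
    unfolding v right_mult_vec[OF d] p'_def[symmetric] cK_mult_vec[OF d' d(2-5)]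
    by (rule left_mult_vec) (use d d' in simp_all)
  also have "\<dots> = (M *\<^sub>v p) @\<^sub>v
      (F *\<^sub>v p + ((K - F * Mi * transpose_mat F) *\<^sub>v u + (F * Mi * G *\<^sub>v w + a *\<^sub>v s))) @\<^sub>v
      (- transpose_mat G *\<^sub>v p + (transpose_mat (F * Mi * G) *\<^sub>v u + (- (transpose_mat G * Mi * G) *\<^sub>v w + b *\<^sub>v t))) @\<^sub>v
      (transpose_mat a *\<^sub>v u) @\<^sub>v (transpose_mat b *\<^sub>v w)"
    unfolding p'_def transpose_FMiG
    by (insert d, (simp only: mult_mat_vec_assoc uminus_mat_mult_vec minus_mat_mult_vec dims
        index_transpose_mat dim_mult_mat_vec index_mult_mat index_uminus_mat index_minus_mat
        index_add_vec index_uminus_vec),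
      (simp only: mult_mat_vec_add mult_mat_vec_uminus dims index_transpose_mat dim_mult_mat_vec
        index_add_vec index_uminus_vec),
      (simp only: inv_mult_vec dims index_transpose_mat dim_mult_mat_vec),
      (intro append_vec_cong refl; intro eq_vecI),
      (simp_all only: index_add_vec index_uminus_vec index_minus_vec dims index_transpose_mat dim_mult_mat_vec),
      (rule ring_ids)+)
  also have "\<dots> = ?r *\<^sub>v v"
  proof -
    have "?r *\<^sub>v v = (M *\<^sub>v p + 0\<^sub>m m N *\<^sub>v (u @\<^sub>v w @\<^sub>v s @\<^sub>v t)) @\<^sub>v
        (cC *\<^sub>v p + cK_hat *\<^sub>v (u @\<^sub>v w @\<^sub>v s @\<^sub>v t))"
      unfolding v by (rule four_block_mat_mult_append_vec) (simp_all add: d N_def)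
    then show ?thesis
      unfolding cC_mult_vec[OF d(1)] cK_hat_mult_vec[OF d(2-5)]
      by (simp add: append_vec_plus_append_vec d N_def)
  qed
  finally show "?l *\<^sub>v v = ?r *\<^sub>v v" .
qed

text \<open>\<open>cM\<close> neither reads \<open>p\<close> nor produces anything in the second
  block, so the shift in \<open>right_mult\<close> leaves no trace.\<close>

lemma reduce_M:
  "left_mult * cM * right_mult = four_block_mat (0\<^sub>m m m) (0\<^sub>m m N) (0\<^sub>m N m) cM_hat" (is "?l = ?r")
proof (rule mat_eqI_mult_vec)
  show "?l \<in> carrier_mat (m + N) (m + N)"
    by (intro carrier_matI) simp_all
  show "?r \<in> carrier_mat (m + N) (m + N)"
    by (intro carrier_matI) simp_all
  fix v :: "'a vec" assume "v \<in> carrier_vec (m + N)"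
  then have "dim_vec v = m + N" by simp
  then obtain p u w s t where v: "v = p @\<^sub>v u @\<^sub>v w @\<^sub>v s @\<^sub>v t"
    and d: "dim_vec p = m" "dim_vec u = n" "dim_vec w = e" "dim_vec s = 1" "dim_vec t = 1"
    by (rule vec_cases)
  have "?l *\<^sub>v v = left_mult *\<^sub>v (cM *\<^sub>v (right_mult *\<^sub>v v))"
    by (subst mult_mat_vec_assoc; use \<open>dim_vec v = m + N\<close> in \<open>simp add: mult_mat_vec_assoc\<close>)
  also have "\<dots> = 0\<^sub>v m @\<^sub>v (X *\<^sub>v u + Y *\<^sub>v w) @\<^sub>v (transpose_mat Y *\<^sub>v u) @\<^sub>v 0\<^sub>v 1 @\<^sub>v 0\<^sub>v 1"
    unfolding v right_mult_vec[OF d]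
    by (simp add: d cM_mult_vec left_mult_vec del: append_vec_zero)
  also have "\<dots> = ?r *\<^sub>v v"
    unfolding v using d
    by (simp add: four_block_mat_mult_append_vec N_def cM_hat_mult_vec)
  finally show "?l *\<^sub>v v = ?r *\<^sub>v v" .
qed

lemma det_left_mult: "Determinant.det left_mult \<noteq> 0"
proof (rule det_nonzeroI[OF carriers(1)])
  fix v :: "'a vec" assume "v \<in> carrier_vec (m + N)" and 0: "left_mult *\<^sub>v v = 0\<^sub>v (m + N)"
  then have "dim_vec v = m + N" by simp
  then obtain u p w s t where v: "v = u @\<^sub>v p @\<^sub>v w @\<^sub>v s @\<^sub>v t"
    and d: "dim_vec p = m" "dim_vec u = n" "dim_vec w = e" "dim_vec s = 1" "dim_vec t = 1"
    by (rule vec_cases')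
  from 0 have "u = 0\<^sub>v n \<and> p = 0\<^sub>v m \<and> w = 0\<^sub>v e \<and> s = 0\<^sub>v 1 \<and> t = 0\<^sub>v 1"
    unfolding v left_mult_vec[OF d] N_def
    by (subst (asm) append_vec_eq_zero_iff5) (use d in simp_all)
  then show "v = 0\<^sub>v (m + N)"
    unfolding v N_def by (simp add: add.left_commute)
qed

text \<open>For a kernel vector, \<open>u\<close> and \<open>w\<close> vanish because they are
  copied to the output; then the shift vanishes, and with it \<open>p\<close>.\<close>

lemma det_right_mult: "Determinant.det right_mult \<noteq> 0"
proof (rule det_nonzeroI[OF carriers(2)])
  fix v :: "'a vec" assume "v \<in> carrier_vec (m + N)" and 0: "right_mult *\<^sub>v v = 0\<^sub>v (m + N)"
  then have "dim_vec v = m + N" by simp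
  then obtain p u w s t where v: "v = p @\<^sub>v u @\<^sub>v w @\<^sub>v s @\<^sub>v t"
    and d: "dim_vec p = m" "dim_vec u = n" "dim_vec w = e" "dim_vec s = 1" "dim_vec t = 1"
    by (rule vec_cases)
  have e: "m + N = n + (m + (e + (1 + 1)))" by (simp add: N_def)
  from 0 have z: "u = 0\<^sub>v n" "w = 0\<^sub>v e" "s = 0\<^sub>v 1" "t = 0\<^sub>v 1"
    and p: "p + (- (Mi * transpose_mat F) *\<^sub>v u + (Mi * G) *\<^sub>v w) = 0\<^sub>v m"
    unfolding v right_mult_vec[OF d] e
    by (subst (asm) append_vec_eq_zero_iff5; use d in simp)+
  from p have "p = 0\<^sub>v m"
    unfolding z using d by (simp add: mult_mat_vec_distribs mult_mat_zero_vec)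
  then show "v = 0\<^sub>v (m + N)"
    unfolding v z N_def by simp
qed

text \<open>Phrases nonsingularity as uniqueness for the five block equations, the form in which the
  energy argument delivers it.\<close>

lemma det_cK_nonzeroI:
  assumes "\<And>u p w s t. dim_vec p = m \<Longrightarrow> dim_vec u = n \<Longrightarrow> dim_vec w = e \<Longrightarrow> dim_vec s = 1 \<Longrightarrow> dim_vec t = 1 \<Longrightarrow>
      K *\<^sub>v u + (F *\<^sub>v p + a *\<^sub>v s) = 0\<^sub>v n \<Longrightarrow>
      transpose_mat F *\<^sub>v u + (M *\<^sub>v p + - G *\<^sub>v w) = 0\<^sub>v m \<Longrightarrow>
      - transpose_mat G *\<^sub>v p + b *\<^sub>v t = 0\<^sub>v e \<Longrightarrow>
      transpose_mat a *\<^sub>v u = 0\<^sub>v 1 \<Longrightarrow> transpose_mat b *\<^sub>v w = 0\<^sub>v 1 \<Longrightarrow>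
      u = 0\<^sub>v n \<and> p = 0\<^sub>v m \<and> w = 0\<^sub>v e \<and> s = 0\<^sub>v 1 \<and> t = 0\<^sub>v 1"
  shows "Determinant.det cK \<noteq> 0"
proof (rule det_nonzeroI[OF carriers(3)])
  fix v :: "'a Matrix.vec" assume "v \<in> carrier_vec (m + N)" and 0: "cK *\<^sub>v v = 0\<^sub>v (m + N)"
  then have "dim_vec v = m + N" by simp
  then obtain u p w s t where v: "v = u @\<^sub>v p @\<^sub>v w @\<^sub>v s @\<^sub>v t"
    and d: "dim_vec p = m" "dim_vec u = n" "dim_vec w = e" "dim_vec s = 1" "dim_vec t = 1"
    by (rule vec_cases')
  have N: "m + N = n + (m + (e + (1 + 1)))" by (simp add: N_def)
  have "u = 0\<^sub>v n \<and> p = 0\<^sub>v m \<and> w = 0\<^sub>v e \<and> s = 0\<^sub>v 1 \<and> t = 0\<^sub>v 1"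
    using 0 unfolding v cK_mult_vec[OF d] N
    by (subst (asm) append_vec_eq_zero_iff5) (use d assms[OF d] in simp_all)
  then show "v = 0\<^sub>v (m + N)"
    unfolding v N by simp
qed

lemma det_M: "Determinant.det M \<noteq> 0"
proof -
  have "Determinant.det M * Determinant.det Mi = 1"
    using inv by (subst det_mult[symmetric, of _ m]) (auto intro: carrier_matI)
  then show ?thesis by auto
qed

end

section \<open>From real block matrices to complex pencils\<close>

locale real_block_elimination = block_elimination n m e K F M Mi G X Y a b
  for n m e :: nat and K F M Mi G X Y a b :: "real mat"
begin

text \<open>The reductions are identities between real matrices. The embedding into the complex
  numbers preserves products, blocks and determinants, so they carry over and the constant factor
  stays nonzero.\<close>

lemma pencil_elimination:
  assumes "Determinant.det cK \<noteq> 0"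
  defines "r \<equiv> map_mat complex_of_real"
  shows "regular_pencil (r cK) (r cM) \<and> regular_pencil (r cK_hat) (r cM_hat) \<and>
        (\<forall>\<mu>. pencil_eigenvalue (r cK) (r cM) \<mu> \<longleftrightarrow> pencil_eigenvalue (r cK_hat) (r cM_hat) \<mu>) \<and>
        replicate_mset m Infinite \<subseteq># pencil_spec (r cK) (r cM) \<and>
        pencil_spec (r cK_hat) (r cM_hat) = pencil_spec (r cK) (r cM) - replicate_mset m Infinite"
proof -
  have M: "M \<in> carrier_mat m m" by (intro carrier_matI) auto
  have det: "Determinant.det (r A) = of_real (Determinant.det A)" for A
    unfolding r_def by (rule of_real_hom.hom_det)
  have mult: "r (A * B * C) = r A * r B * r C"
    if "A \<in> carrier_mat (m + N) (m + N)" "B \<in> carrier_mat (m + N) (m + N)" "C \<in> carrier_mat (m + N) (m + N)"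
    for A B C
    using that by (simp add: r_def of_real_hom.mat_hom_mult[of _ "m+N" "m+N" _ "m+N"])
  have zero: "r (0\<^sub>m i j) = 0\<^sub>m i j" for i j
    by (intro eq_matI) (auto simp: r_def)
  have LKQ: "r left_mult * r cK * r right_mult = four_block_mat (r M) (0\<^sub>m m N) (r cC) (r cK_hat)"
    using mult[OF carriers(1,3,2)] map_four_block_mat[OF M zero_carrier_mat carriers(7,5), of complex_of_real]
    by (simp add: reduce_K zero flip: r_def)
  have LMQ: "r left_mult * r cM * r right_mult = four_block_mat (0\<^sub>m m m) (0\<^sub>m m N) (0\<^sub>m N m) (r cM_hat)"
    using mult[OF carriers(1,4,2)]
      map_four_block_mat[OF zero_carrier_mat zero_carrier_mat zero_carrier_mat carriers(6), of complex_of_real]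
    by (simp add: reduce_M zero flip: r_def)
  have c: "r A \<in> carrier_mat i j" if "A \<in> carrier_mat i j" for A i j
    using that by (simp add: r_def)
  note rc = carriers[THEN c]
  have pp: "pencil_poly (r cK) (r cM) = Polynomial.smult (Determinant.det (r M) /
      (Determinant.det (r left_mult) * Determinant.det (r right_mult))) (pencil_poly (r cK_hat) (r cM_hat))"
    by (rule pencil_poly_block_triangular[OF rc(3,4,1,2,5,6) c[OF M] rc(7) LKQ LMQ])
       (simp_all only: det of_real_eq_0_iff det_left_mult det_right_mult not_False_eq_True)
  show ?thesis
    by (rule pencil_spec_reduction[OF rc(3-6) _ pp])
       (use assms(1) in \<open>simp_all only: det of_real_eq_0_iff det_left_mult det_right_mult det_M
         divide_eq_0_iff mult_eq_0_iff not_False_eq_True disj_not1 simp_thms\<close>)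
qed

end

subsection \<open>The coefficient\<close>

text \<open>\<open>matrix_inv\<close> picks a two-sided inverse by choice; for square matrices a
  right inverse is two-sided, and two-sided inverses are unique.\<close>

lemma matrix_inv_eqI:
  fixes A B :: "real^'n^'n"
  assumes "A ** B = Finite_Cartesian_Product.mat 1"
  shows "matrix_inv A = B"
proof -
  have BA: "B ** A = Finite_Cartesian_Product.mat 1"
    using assms by (simp add: matrix_left_right_inverse)
  have "A ** matrix_inv A = Finite_Cartesian_Product.mat 1"
    unfolding matrix_inv_def
    by (rule someI2[of _ B]) (use assms BA in auto)
  then have "B ** (A ** matrix_inv A) = B" by simp
  then show ?thesis by (simp add: matrix_mul_assoc BA)
qed

lemma invertible_if_kernel_trivial:
  fixes B :: "real^'n^'n"
  assumes "\<And>\<xi>. B *v \<xi> = 0 \<Longrightarrow> \<xi> = 0"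
  shows "invertible B"
  using assms matrix_left_invertible_ker[of B] by (auto simp: invertible_left_inverse)

lemma matrix_inv_right_inverse:
  fixes B :: "real^'n^'n"
  assumes "invertible B"
  shows "B ** matrix_inv B = Finite_Cartesian_Product.mat 1"
  using assms matrix_inv_eqI unfolding invertible_def by metis

text \<open>A vector in the kernel of \<open>I - B\<close> is fixed by \<open>B\<close>, which the
  bound with \<open>k < 1\<close> allows only for 0. The formula comes from
  \<open>(B\<^sup>-\<^sup>1 - I) B = I - B\<close>; its right-hand side contains a single inverse,
  which serves the measurability of \<open>P\<close>.\<close>

lemma coefficient_inverse:
  fixes B :: "real^'d^'d"
  assumes spd: "sym_pos_def B" and k: "k < 1"
    and ub: "\<And>\<xi>. \<xi> \<bullet> (B *v \<xi>) \<le> k * (norm \<xi>)\<^sup>2"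
  shows "invertible (Finite_Cartesian_Product.mat 1 - B)"
    and "matrix_inv (matrix_inv B - Finite_Cartesian_Product.mat 1)
      = B ** matrix_inv (Finite_Cartesian_Product.mat 1 - B)"
proof -
  let ?I = "Finite_Cartesian_Product.mat 1 :: real^'d^'d"
  have "\<xi> = 0" if "(?I - B) *v \<xi> = 0" for \<xi>
  proof -
    from that have "B *v \<xi> = \<xi>" by (simp add: matrix_vector_mult_diff_rdistrib)
    then have "(norm \<xi>)\<^sup>2 \<le> k * (norm \<xi>)\<^sup>2"
      using ub[of \<xi>] by (simp add: power2_norm_eq_inner)
    then have "(1 - k) * (norm \<xi>)\<^sup>2 \<le> 0" by (simp add: algebra_simps)
    then show ?thesis using k by (simp add: mult_le_0_iff)
  qed
  then show I: "invertible (?I - B)" by (rule invertible_if_kernel_trivial)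
  have "\<xi> = 0" if "B *v \<xi> = 0" for \<xi>
    using spd that unfolding sym_pos_def_def by (metis inner_zero_right less_irrefl)
  then have B: "invertible B" by (rule invertible_if_kernel_trivial)
  then have "matrix_inv B ** B = ?I"
    using matrix_inv_right_inverse matrix_left_right_inverse by blast
  then have "matrix_inv B *v (B *v x) = x" for x
    by (simp add: matrix_vector_mul_assoc)
  then have "(matrix_inv B - ?I) ** B = ?I - B"
    by (simp add: matrix_eq matrix_vector_mult_diff_rdistrib flip: matrix_vector_mul_assoc)
  then have "(matrix_inv B - ?I) ** (B ** matrix_inv (?I - B)) = ?I"
    using matrix_inv_right_inverse[OF I] by (simp add: matrix_mul_assoc)
  then show "matrix_inv (matrix_inv B - ?I) = B ** matrix_inv (?I - B)"
    by (rule matrix_inv_eqI)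
qed

lemma sym_pos_def_inner:
  "sym_pos_def B \<Longrightarrow> x \<bullet> (B *v y) = (B *v x) \<bullet> y"
  unfolding sym_pos_def_def by (metis dot_lmul_matrix vector_transpose_matrix)

text \<open>Writing \<open>\<xi> = \<zeta> - B \<zeta>\<close> turns statements on \<open>(B\<^sup>-\<^sup>1 - I)\<^sup>-\<^sup>1\<close> into statements on \<open>B\<close>.\<close>

lemma coefficient_inverse_vec:
  fixes B :: "real^'d^'d"
  assumes spd: "sym_pos_def B" and k: "k < 1"
    and ub: "\<And>\<xi>. \<xi> \<bullet> (B *v \<xi>) \<le> k * (norm \<xi>)\<^sup>2"
  defines "Q \<equiv> matrix_inv (matrix_inv B - Finite_Cartesian_Product.mat 1)"
  obtains \<zeta> where "\<xi> = \<zeta> - B *v \<zeta>" "Q *v \<xi> = B *v \<zeta>"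
proof -
  let ?I = "Finite_Cartesian_Product.mat 1 :: real^'d^'d"
  define \<zeta> where "\<zeta> = matrix_inv (?I - B) *v \<xi>"
  have "(?I - B) *v \<zeta> = \<xi>"
    using matrix_inv_right_inverse[OF coefficient_inverse(1)[OF spd k ub]]
    by (simp add: \<zeta>_def matrix_vector_mul_assoc)
  moreover have "Q *v \<xi> = B *v \<zeta>"
    by (simp add: Q_def coefficient_inverse(2)[OF spd k ub] \<zeta>_def matrix_vector_mul_assoc)
  ultimately show thesis
    using that[of \<zeta>] by (simp add: matrix_vector_mult_diff_rdistrib)
qed

text \<open>The coercivity is measured in the image \<open>Q *v \<xi>\<close>. With injectivity it
  makes \<open>Q\<close> positive definite, and with Cauchy-Schwarz it bounds \<open>Q\<close> by
  \<open>1 / (1 - k)\<close>, so that \<open>Q\<close> preserves boundedness of fields.\<close>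

lemma coefficient_inverse_properties:
  fixes B :: "real^'d^'d"
  assumes spd: "sym_pos_def B" and k: "k < 1"
    and ub: "\<And>\<xi>. \<xi> \<bullet> (B *v \<xi>) \<le> k * (norm \<xi>)\<^sup>2"
  defines "Q \<equiv> matrix_inv (matrix_inv B - Finite_Cartesian_Product.mat 1)"
  shows coefficient_inverse_sym: "\<xi> \<bullet> (Q *v \<eta>) = (Q *v \<xi>) \<bullet> \<eta>"
    and coefficient_inverse_coercive: "(1 - k) * (norm (Q *v \<xi>))\<^sup>2 \<le> (Q *v \<xi>) \<bullet> \<xi>"
    and coefficient_inverse_inj: "Q *v \<xi> = 0 \<Longrightarrow> \<xi> = 0"
    and coefficient_inverse_bound: "norm (Q *v \<xi>) \<le> norm \<xi> / (1 - k)"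
proof -
  note ex = coefficient_inverse_vec[OF spd k ub, folded Q_def]
  note sym = sym_pos_def_inner[OF spd]
  have pos: "0 \<le> \<zeta> \<bullet> (B *v \<zeta>)" for \<zeta>
    using spd unfolding sym_pos_def_def by (cases "\<zeta> = 0") (auto intro: less_imp_le)
  obtain \<zeta> where \<zeta>: "\<xi> = \<zeta> - B *v \<zeta>" "Q *v \<xi> = B *v \<zeta>" by (rule ex)
  obtain \<zeta>' where \<zeta>': "\<eta> = \<zeta>' - B *v \<zeta>'" "Q *v \<eta> = B *v \<zeta>'" by (rule ex)
  show "\<xi> \<bullet> (Q *v \<eta>) = (Q *v \<xi>) \<bullet> \<eta>"
    by (simp add: \<zeta>(2) \<zeta>'(2)) (simp add: \<zeta>(1) \<zeta>'(1) sym inner_diff matrix_vector_mult_diff_distrib)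
  \<comment> \<open>The form of \<open>B\<close> is nonnegative at this vector. Bounding the last
    term of its expansion by \<open>k\<close> times the squared norm of \<open>B *v \<zeta>\<close>
    gives \<open>\<zeta> \<bullet> (B *v \<zeta>)\<close> at least \<open>2 - k\<close> times that
    squared norm, which is coercivity after the substitution.\<close>
  let ?\<omega> = "\<zeta> - B *v \<zeta>"
  have "?\<omega> \<bullet> (B *v ?\<omega>)
      = \<zeta> \<bullet> (B *v \<zeta>) - \<zeta> \<bullet> (B *v (B *v \<zeta>)) - (B *v \<zeta>) \<bullet> (B *v \<zeta>) + (B *v \<zeta>) \<bullet> (B *v (B *v \<zeta>))"
    by (simp add: inner_diff_left inner_diff_right matrix_vector_mult_diff_distrib)
  moreover have "\<zeta> \<bullet> (B *v (B *v \<zeta>)) = (B *v \<zeta>) \<bullet> (B *v \<zeta>)"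
    by (rule sym)
  ultimately have "2 * (norm (B *v \<zeta>))\<^sup>2 - k * (norm (B *v \<zeta>))\<^sup>2 \<le> \<zeta> \<bullet> (B *v \<zeta>)"
    using pos[of ?\<omega>] ub[of "B *v \<zeta>"] by (simp add: power2_norm_eq_inner)
  then show co: "(1 - k) * (norm (Q *v \<xi>))\<^sup>2 \<le> (Q *v \<xi>) \<bullet> \<xi>"
    unfolding \<zeta>(2) unfolding \<zeta>(1)
    by (simp add: left_diff_distrib power2_norm_eq_inner inner_diff_right inner_commute[of _ \<zeta>])
  show "\<xi> = 0" if "Q *v \<xi> = 0"
  proof -
    from that have "\<zeta> \<bullet> (B *v \<zeta>) = 0" by (simp add: \<zeta>(2))
    then have "\<zeta> = 0" using spd unfolding sym_pos_def_def by force
    then show ?thesis by (simp add: \<zeta>(1))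
  qed
  have "(1 - k) * norm (Q *v \<xi>) * norm (Q *v \<xi>) \<le> norm \<xi> * norm (Q *v \<xi>)"
    using co norm_cauchy_schwarz[of "Q *v \<xi>" \<xi>] by (simp add: power2_eq_square algebra_simps)
  then have "(1 - k) * norm (Q *v \<xi>) \<le> norm \<xi>"
    by (cases "Q *v \<xi> = 0") auto
  then show "norm (Q *v \<xi>) \<le> norm \<xi> / (1 - k)"
    using k by (simp add: field_simps)
qed

section \<open>Measurability of vector and matrix valued maps\<close>

lemma measurable_vec_lambda:
  fixes f :: "'a \<Rightarrow> 'n::finite \<Rightarrow> 'b::euclidean_space"
  assumes "\<And>i. (\<lambda>x. f x i) \<in> borel_measurable M"
  shows "(\<lambda>x. \<chi> i. f x i) \<in> borel_measurable M"
proof (subst borel_measurable_euclidean_space, intro ballI)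
  fix b :: "'b^'n" assume "b \<in> Basis"
  then obtain i u where "b = axis i u" by (auto simp: Basis_vec_def)
  then have "(\<chi> i. f x i) \<bullet> b = f x i \<bullet> u" for x
    by (simp add: inner_axis)
  then show "(\<lambda>x. (\<chi> i. f x i) \<bullet> b) \<in> borel_measurable M"
    using assms[of i] by simp
qed

lemma measurable_vec_nth:
  fixes f :: "'a \<Rightarrow> 'b::euclidean_space^'n"
  assumes "f \<in> borel_measurable M"
  shows "(\<lambda>x. f x $ i) \<in> borel_measurable M"
proof -
  have "continuous_on UNIV (\<lambda>x::'b^'n. x $ i)"
    by (intro continuous_intros)
  from borel_measurable_continuous_on[OF this assms] show ?thesis .
qed

lemma measurable_matrix_vector_mult:
  fixes A :: "'a \<Rightarrow> real^'n^'m"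
  assumes "A \<in> borel_measurable M" "f \<in> borel_measurable M"
  shows "(\<lambda>x. A x *v f x) \<in> borel_measurable M"
  unfolding matrix_vector_mult_def
  by (intro measurable_vec_lambda borel_measurable_sum borel_measurable_times measurable_vec_nth assms)

lemma measurable_det:
  fixes A :: "'a \<Rightarrow> real^'n^'n"
  assumes "A \<in> borel_measurable M"
  shows "(\<lambda>x. Determinants.det (A x)) \<in> borel_measurable M"
  unfolding Determinants.det_def
  by (intro borel_measurable_sum borel_measurable_times borel_measurable_prod measurable_vec_nth assms
      borel_measurable_const)

text \<open>Cramer's rule writes each component as a quotient of determinants, and determinants are
  polynomials in the measurable entries.\<close>

lemma measurable_matrix_inv_vector_mult:
  fixes A :: "'a \<Rightarrow> real^'n^'n"
  assumes A: "A \<in> borel_measurable M" and f: "f \<in> borel_measurable M"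
    and inv: "\<And>x. x \<in> space M \<Longrightarrow> invertible (A x)"
  shows "(\<lambda>x. matrix_inv (A x) *v f x) \<in> borel_measurable M"
proof -
  have "matrix_inv (A x) *v f x
      = (\<chi> k. Determinants.det (\<chi> i j. if j = k then f x $ i else A x $ i $ j) / Determinants.det (A x))"
    if "x \<in> space M" for x
  proof -
    have "A x *v (matrix_inv (A x) *v f x) = f x"
      using matrix_inv_right_inverse[OF inv[OF that]] by (simp add: matrix_vector_mul_assoc)
    then show ?thesis
      using cramer[of "A x" "matrix_inv (A x) *v f x" "f x"] inv[OF that]
      by (simp add: invertible_det_nz)
  qed
  moreover have "(\<lambda>x. \<chi> k. Determinants.det (\<chi> i j. if j = k then f x $ i else A x $ i $ j) / Determinants.det (A x))
      \<in> borel_measurable M"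
  proof (intro measurable_vec_lambda borel_measurable_divide measurable_det A)
    show "(\<lambda>x. if j = k then f x $ i else A x $ i $ j) \<in> borel_measurable M" for i j k
      by (cases "j = k") (auto intro!: measurable_vec_nth f A)
  qed
  ultimately show ?thesis
    by (subst measurable_cong) auto
qed

subsection \<open>Functions on a mesh\<close>

text \<open>Both derivatives are evaluated at \<open>D - E\<close>. Uniqueness is what allows the
  definite description in \<open>grad\<close> to be resolved.\<close>

lemma GDERIV_unique:
  assumes "GDERIV f x :> D" "GDERIV f x :> E"
  shows "D = E"
proof -
  have "(\<lambda>h. h \<bullet> D) = (\<lambda>h. h \<bullet> E)"
    using assms unfolding gderiv_def by (rule has_derivative_unique)
  then have "(D - E) \<bullet> D = (D - E) \<bullet> E" by metis
  then have "(D - E) \<bullet> (D - E) = 0" by (simp add: inner_diff_right)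
  then show ?thesis by simp
qed

lemma grad_affine:
  assumes "\<And>y. y \<in> T \<Longrightarrow> f y = a \<bullet> y + c" "x \<in> interior T"
  shows "grad f x = a"
proof -
  have "((\<lambda>y. a \<bullet> y + c) has_derivative (\<lambda>h. h \<bullet> a)) (at x)"
    by (auto intro!: derivative_eq_intros simp: inner_commute)
  then have "(f has_derivative (\<lambda>h. h \<bullet> a)) (at x)"
    by (rule has_derivative_transform_within_open[of _ _ _ _ "interior T"])
       (use assms interior_subset[of T] in \<open>auto simp: subset_iff\<close>)
  then show ?thesis
    unfolding grad_def gderiv_def[symmetric] by (blast intro: GDERIV_unique the_equality)
qed

section \<open>Geometry of the mesh\<close>

locale mesh_domain =
  fixes \<Omega> :: "'a::euclidean_space set" and \<T> :: "'a set set"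
  assumes domain: "polyhedral_domain \<Omega>" and mesh: "simplicial_mesh \<Omega> \<T>"
begin

abbreviation L :: "'a measure" where "L \<equiv> lebesgue_on \<Omega>"

text \<open>Here every piecewise linear function is locally affine; the rest of \<Omega> lies on
  cell boundaries and is null.\<close>

definition mesh_interior :: "'a set" where "mesh_interior = (\<Union>T\<in>\<T>. interior T)"

lemma open_domain: "open \<Omega>" and bounded_domain: "bounded \<Omega>" and domain_nonempty: "\<Omega> \<noteq> {}"
  and connected_domain: "connected \<Omega>" and domain_regular: "interior (closure \<Omega>) = \<Omega>"
  using domain unfolding polyhedral_domain_def by auto

lemma finite_mesh: "finite \<T>"
  and simplex_mesh: "T \<in> \<T> \<Longrightarrow> int DIM('a) simplex T"
  and Union_mesh: "\<Union>\<T> = closure \<Omega>"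
  using mesh unfolding simplicial_mesh_def triangulation_def by auto

lemma convex_cell: "T \<in> \<T> \<Longrightarrow> convex T"
  and compact_cell: "T \<in> \<T> \<Longrightarrow> compact T"
  using simplex_mesh simplex_imp_polytope polytope_imp_convex polytope_imp_compact by blast+

text \<open>A nonempty convex set has nonempty relative interior, which is the interior because the
  simplex has full dimension.\<close>

lemma interior_cell_nonempty: "T \<in> \<T> \<Longrightarrow> interior T \<noteq> {}"
proof -
  assume T: "T \<in> \<T>"
  have d: "aff_dim T = int DIM('a)"
    using aff_dim_simplex[OF simplex_mesh[OF T]] .
  then have "T \<noteq> {}" by auto
  then have "rel_interior T \<noteq> {}"
    using rel_interior_eq_empty[OF convex_cell[OF T]] by simp
  then show ?thesis using interior_rel_interior[OF d] by simp
qed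

lemma cell_subset: "T \<in> \<T> \<Longrightarrow> T \<subseteq> closure \<Omega>"
  using Union_mesh by auto

text \<open>Passing to interiors gives a subset of the interior of the closure, which is \<Omega>
  itself since slits are excluded.\<close>

lemma interior_cell_subset: "T \<in> \<T> \<Longrightarrow> interior T \<subseteq> \<Omega>"
  using interior_mono[OF cell_subset] domain_regular by simp

lemma domain_measurable [simp]: "\<Omega> \<in> sets lebesgue"
  using open_domain by (simp add: borel_open)

lemma space_L [simp]: "space L = \<Omega>"
  by simp

lemma finite_measure_L: "finite_measure L"
proof (rule finite_measureI)
  have "emeasure L (space L) = emeasure lebesgue \<Omega>"
    by (subst emeasure_restrict_space) auto
  then show "emeasure L (space L) \<noteq> \<infinity>"
    using fmeasurableD2[OF bounded_set_imp_lmeasurable[OF bounded_domain domain_measurable]] by simp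
qed

lemma open_mesh_interior: "open mesh_interior"
  by (auto simp: mesh_interior_def)

text \<open>A point outside all open cells lies on the frontier of a cell, and the frontiers of
  finitely many convex sets form a null set.\<close>

lemma domain_minus_mesh_interior_null: "\<Omega> - mesh_interior \<in> null_sets L"
proof -
  have "negligible (\<Union>T\<in>\<T>. frontier T)"
    using finite_mesh convex_cell negligible_convex_frontier by (intro negligible_Union) auto
  moreover have "\<Omega> - mesh_interior \<subseteq> (\<Union>T\<in>\<T>. frontier T)"
  proof
    fix x assume x: "x \<in> \<Omega> - mesh_interior"
    then obtain T where "T \<in> \<T>" "x \<in> T"
      using Union_mesh closure_subset[of \<Omega>] by blast
    then show "x \<in> (\<Union>T\<in>\<T>. frontier T)"
      using x closure_subset[of T] unfolding frontier_def mesh_interior_def by blast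
  qed
  ultimately have "negligible (\<Omega> - mesh_interior)" by (rule negligible_subset)
  then show ?thesis
    by (simp add: negligible_iff_null_sets null_sets_restrict_space)
qed

lemma AE_mesh_interior: "AE x in L. x \<in> mesh_interior"
  by (rule AE_I'[OF domain_minus_mesh_interior_null]) auto

text \<open>Nonempty open sets are not null. This turns a statement almost everywhere into one at
  some point of each cell, which decides the value of a function constant on cells.\<close>

lemma AE_open_ex:
  assumes "AE x in L. Q x" "open U" "U \<noteq> {}" "U \<subseteq> \<Omega>"
  shows "\<exists>x\<in>U. Q x"
proof (rule ccontr)
  assume *: "\<not> (\<exists>x\<in>U. Q x)"
  have "AE x in lebesgue. x \<in> \<Omega> \<longrightarrow> Q x"
    using assms(1) by (subst (asm) AE_restrict_space_iff) auto
  then have "AE x in lebesgue. x \<notin> U"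
    by eventually_elim (use * assms(4) in auto)
  then have "U \<in> null_sets lebesgue"
    by (simp add: completion.AE_iff_null_sets)
  then show False
    using open_not_negligible[OF assms(2,3)] by (simp add: negligible_iff_null_sets)
qed

section \<open>Piecewise constant and piecewise linear functions\<close>

lemma pw_constant_finite_range: "w \<in> pw_constant \<T> \<Longrightarrow> finite (range w)"
proof -
  assume w: "w \<in> pw_constant \<T>"
  then obtain c where c: "\<And>T x. T \<in> \<T> \<Longrightarrow> x \<in> interior T \<Longrightarrow> w x = c T"
    unfolding pw_constant_def by (auto; metis)
  have "range w \<subseteq> insert 0 (c ` \<T>)"
    using w c unfolding pw_constant_def by fastforce
  then show ?thesis using finite_mesh by (meson finite.insertI finite_imageI finite_subset)
qed

text \<open>A preimage is a union of open cells, together with the closed complement of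
  \<open>mesh_interior\<close> when the set contains 0.\<close>

lemma pw_constant_measurable: "w \<in> pw_constant \<T> \<Longrightarrow> w \<in> borel_measurable L"
proof -
  assume w: "w \<in> pw_constant \<T>"
  have "w -` B \<in> sets borel" for B
  proof -
    have "w -` B = (\<Union>T\<in>{T\<in>\<T>. \<exists>x\<in>interior T. w x \<in> B}. interior T) \<union> (if 0 \<in> B then - mesh_interior else {})"
      using w unfolding pw_constant_def mesh_interior_def by (auto split: if_splits) metis+
    moreover have "open (\<Union>T\<in>{T\<in>\<T>. \<exists>x\<in>interior T. w x \<in> B}. interior T)" by auto
    ultimately show ?thesis using open_mesh_interior by (auto intro!: sets.Un borel_open)
  qed
  then have "w \<in> borel_measurable borel" by (auto simp: measurable_def)
  then show ?thesis
    by (intro measurable_restrict_space1 measurable_completion) simp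
qed

text \<open>Each open cell contains a point where \<open>w\<close> vanishes, and off the open cells
  the chosen representative is zero. Equality almost everywhere thus becomes equality of functions,
  to which linear independence applies.\<close>

lemma pw_constant_eq_zero:
  assumes w: "w \<in> pw_constant \<T>" and ae: "AE x in L. w x = 0"
  shows "w = (\<lambda>_. 0)"
proof
  fix x
  show "w x = 0"
  proof (cases "x \<in> mesh_interior")
    case True
    then obtain T where T: "T \<in> \<T>" "x \<in> interior T" by (auto simp: mesh_interior_def)
    obtain y where "y \<in> interior T" "w y = 0"
      using AE_open_ex[OF ae, of "interior T"] T interior_cell_subset by auto
    moreover obtain c where "\<And>z. z \<in> interior T \<Longrightarrow> w z = c"
      using w T unfolding pw_constant_def by auto
    ultimately show ?thesis using T by metis
  qed (use w in \<open>auto simp: pw_constant_def mesh_interior_def\<close>)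
qed

text \<open>\<open>grad\<close> is unspecified where the function is not differentiable. Setting it
  to zero off the open cells gives a representative in \<open>pw_constant\<close>, so that gradients
  add and expand in a basis at every point.\<close>

definition dgrad :: "('a \<Rightarrow> real) \<Rightarrow> 'a \<Rightarrow> 'a" where
  "dgrad f x = (if x \<in> mesh_interior then grad f x else 0)"

lemma pw_linearD:
  assumes "f \<in> pw_linear \<Omega> \<T>" "T \<in> \<T>"
  obtains a c where "\<And>y. y \<in> T \<Longrightarrow> f y = a \<bullet> y + c"
proof -
  from assms have "\<exists>a c. \<forall>y\<in>T. f y = a \<bullet> y + c" unfolding pw_linear_def by auto
  then show thesis using that by blast
qed

lemma dgrad_pw_constant:
  assumes "f \<in> pw_linear \<Omega> \<T>"
  shows "dgrad f \<in> pw_constant \<T>"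
proof -
  have "\<exists>c. \<forall>x\<in>interior T. dgrad f x = c" if T: "T \<in> \<T>" for T
  proof -
    obtain a c where "\<And>y. y \<in> T \<Longrightarrow> f y = a \<bullet> y + c" by (rule pw_linearD[OF assms T]) blast
    then have "grad f x = a" if "x \<in> interior T" for x
      using that by (rule grad_affine)
    then have "\<forall>x\<in>interior T. dgrad f x = a"
      using T by (auto simp: dgrad_def mesh_interior_def)
    then show ?thesis by blast
  qed
  then show ?thesis by (auto simp: pw_constant_def dgrad_def mesh_interior_def)
qed

lemma pw_linear_sum:
  assumes "\<And>j. j \<in> J \<Longrightarrow> f j \<in> pw_linear \<Omega> \<T>"
  shows "(\<lambda>x. \<Sum>j\<in>J. u j *\<^sub>R f j x) \<in> pw_linear \<Omega> \<T>"
proof -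
  have "\<exists>a c. \<forall>x\<in>T. (\<Sum>j\<in>J. u j *\<^sub>R f j x) = a \<bullet> x + c" if T: "T \<in> \<T>" for T
  proof -
    have "\<forall>j\<in>J. \<exists>a c. \<forall>y\<in>T. f j y = a \<bullet> y + c"
      using assms T unfolding pw_linear_def by auto
    then obtain a c where "\<And>j y. j \<in> J \<Longrightarrow> y \<in> T \<Longrightarrow> f j y = a j \<bullet> y + c j" by metis
    then have "\<forall>x\<in>T. (\<Sum>j\<in>J. u j *\<^sub>R f j x) = (\<Sum>j\<in>J. u j *\<^sub>R a j) \<bullet> x + (\<Sum>j\<in>J. u j * c j)"
      by (simp add: inner_sum_left sum.distrib[symmetric] algebra_simps)
    then show ?thesis by blast
  qed
  moreover have "continuous_on (closure \<Omega>) (\<lambda>x. \<Sum>j\<in>J. u j *\<^sub>R f j x)"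
    using assms unfolding pw_linear_def by (intro continuous_intros) auto
  moreover have "\<forall>x. x \<notin> closure \<Omega> \<longrightarrow> (\<Sum>j\<in>J. u j *\<^sub>R f j x) = 0"
    using assms unfolding pw_linear_def by simp
  ultimately show ?thesis by (simp add: pw_linear_def)
qed

lemma dgrad_sum:
  assumes "\<And>j. j \<in> J \<Longrightarrow> f j \<in> pw_linear \<Omega> \<T>"
  shows "dgrad (\<lambda>x. \<Sum>j\<in>J. u j *\<^sub>R f j x) x = (\<Sum>j\<in>J. u j *\<^sub>R dgrad (f j) x)"
proof (cases "x \<in> mesh_interior")
  case True
  then obtain T where T: "T \<in> \<T>" "x \<in> interior T" by (auto simp: mesh_interior_def)
  have "\<forall>j\<in>J. \<exists>a c. \<forall>y\<in>T. f j y = a \<bullet> y + c"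
    using assms T unfolding pw_linear_def by auto
  then obtain a c where ac: "\<And>j y. j \<in> J \<Longrightarrow> y \<in> T \<Longrightarrow> f j y = a j \<bullet> y + c j" by metis
  then have "grad (\<lambda>x. \<Sum>j\<in>J. u j *\<^sub>R f j x) x = (\<Sum>j\<in>J. u j *\<^sub>R a j)"
    by (intro grad_affine[where T = T and c = "\<Sum>j\<in>J. u j * c j"] T)
       (simp add: inner_sum_left sum.distrib[symmetric] algebra_simps)
  moreover have "grad (f j) x = a j" if "j \<in> J" for j
    using grad_affine[OF ac[OF that] T(2)] .
  ultimately show ?thesis using True by (simp add: dgrad_def)
qed (simp add: dgrad_def)

text \<open>Zero slope on each of finitely many cells leaves finitely many values; the image of the
  connected closure is connected and finite, hence a single point.\<close>

lemma pw_linear_constant: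
  assumes f: "f \<in> pw_linear \<Omega> \<T>" and 0: "dgrad f = (\<lambda>_. 0)"
  obtains c where "\<And>x. x \<in> closure \<Omega> \<Longrightarrow> f x = c"
proof -
  have "\<exists>c. \<forall>x\<in>T. f x = c" if T: "T \<in> \<T>" for T
  proof -
    obtain a c where ac: "\<And>y. y \<in> T \<Longrightarrow> f y = a \<bullet> y + c" by (rule pw_linearD[OF f T]) blast
    obtain x where x: "x \<in> interior T" using interior_cell_nonempty[OF T] by blast
    have "dgrad f x = a"
      using T x grad_affine[OF ac x] by (auto simp: dgrad_def mesh_interior_def)
    then show ?thesis using 0 ac by auto
  qed
  then obtain k where k: "\<And>T x. T \<in> \<T> \<Longrightarrow> x \<in> T \<Longrightarrow> f x = k T" by metis
  have "f ` closure \<Omega> \<subseteq> k ` \<T>"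
    using k Union_mesh by fastforce
  then have "finite (f ` closure \<Omega>)" using finite_mesh finite_surj by blast
  moreover have "connected (f ` closure \<Omega>)"
    using f connected_imp_connected_closure[OF connected_domain]
    by (intro connected_continuous_image) (auto simp: pw_linear_def)
  ultimately obtain c where "f ` closure \<Omega> = {c}"
    using domain_nonempty connected_finite_iff_sing[of "f ` closure \<Omega>"] by auto
  then show thesis by (intro that[of c]) blast
qed

lemma pw_linear_measurable: "f \<in> pw_linear \<Omega> \<T> \<Longrightarrow> f \<in> borel_measurable L"
  using continuous_imp_measurable_on_sets_lebesgue[OF _ domain_measurable]
    continuous_on_subset[OF _ closure_subset] unfolding pw_linear_def by blast

lemma pw_linear_bounded: "f \<in> pw_linear \<Omega> \<T> \<Longrightarrow> bounded (f ` \<Omega>)"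
proof -
  assume "f \<in> pw_linear \<Omega> \<T>"
  then have "compact (f ` closure \<Omega>)"
    using bounded_domain by (intro compact_continuous_image) (auto simp: pw_linear_def compact_closure)
  then show ?thesis
    by (meson bounded_subset closure_subset compact_imp_bounded image_mono)
qed

text \<open>The constant function 1 in the representation by zero extension; as a test function it
  isolates the second Lagrange multiplier.\<close>

lemma indicator_pw_linear: "indicator (closure \<Omega>) \<in> pw_linear \<Omega> \<T>"
proof -
  have "continuous_on (closure \<Omega>) (indicator (closure \<Omega>) :: 'a \<Rightarrow> real)"
    by (rule continuous_on_eq[of _ "\<lambda>_. 1"]) auto
  moreover have "\<exists>a c. \<forall>x\<in>T. indicator (closure \<Omega>) x = a \<bullet> x + (c::real)" if "T \<in> \<T>" for T
    using cell_subset[OF that] by (intro exI[of _ 0] exI[of _ 1]) (auto simp: subset_iff)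
  ultimately show ?thesis unfolding pw_linear_def by auto
qed

text \<open>On a cell the function is affine, so nonnegativity describes a half-space. It contains
  the vertices, hence their convex hull, which is the cell by Krein-Milman.\<close>

lemma pw_linear_nonneg:
  assumes f: "f \<in> pw_linear \<Omega> \<T>" and v: "\<And>v. v \<in> mesh_vertices \<T> \<Longrightarrow> 0 \<le> f v" and x: "x \<in> closure \<Omega>"
  shows "0 \<le> f x"
proof -
  obtain T where T: "T \<in> \<T>" "x \<in> T" using x Union_mesh by blast
  obtain a c where ac: "\<And>y. y \<in> T \<Longrightarrow> f y = a \<bullet> y + c" by (rule pw_linearD[OF f T(1)]) blast
  have "T \<subseteq> {y. - c \<le> a \<bullet> y}"
  proof -
    have "{v. v extreme_point_of T} \<subseteq> {y. - c \<le> a \<bullet> y}"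
    proof safe
      fix v assume v': "v extreme_point_of T"
      then have "v \<in> T" "v \<in> mesh_vertices \<T>"
        using T by (auto simp: extreme_point_of_def mesh_vertices_def)
      then show "- c \<le> a \<bullet> v" using v ac by force
    qed
    then have "convex hull {v. v extreme_point_of T} \<subseteq> {y. - c \<le> a \<bullet> y}"
      by (rule hull_minimal) (use convex_halfspace_ge[of "-c" a] in simp)
    then show ?thesis
      using Krein_Milman_Minkowski[OF compact_cell[OF T(1)] convex_cell[OF T(1)]] by simp
  qed
  then show ?thesis using ac T by force
qed

end

section \<open>Expansions in bases of function spaces\<close>

lemma sum_fun_apply: "(\<Sum>i\<in>J. f i) x = (\<Sum>i\<in>J. f i x)"
  for f :: "'i \<Rightarrow> 'a \<Rightarrow> 'b::comm_monoid_add"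
  by (induction J rule: infinite_finite_induct) auto

lemma is_basis_mem:
  assumes "is_basis n b V" "i < n"
  shows "b i \<in> V"
  using assms unfolding is_basis_def by (auto intro: fun_space.span_base)

lemma is_basis_combination:
  fixes b :: "nat \<Rightarrow> 'a \<Rightarrow> 'b::real_vector"
  assumes "is_basis n b V"
  shows "(\<lambda>x. \<Sum>i<n. c i *\<^sub>R b i x) \<in> V"
proof -
  have "(\<Sum>i<n. (\<lambda>x. c i *\<^sub>R b i x)) \<in> fun_space.span (b ` {..<n})"
    by (intro fun_space.span_sum fun_space.span_scale fun_space.span_base) auto
  moreover have "(\<Sum>i<n. (\<lambda>x. c i *\<^sub>R b i x)) = (\<lambda>x. \<Sum>i<n. c i *\<^sub>R b i x)"
    by (rule ext) (simp add: sum_fun_apply)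
  ultimately show ?thesis using assms by (simp add: is_basis_def)
qed

lemma is_basis_expansion:
  fixes b :: "nat \<Rightarrow> 'a \<Rightarrow> 'b::real_vector"
  assumes b: "is_basis n b V" and v: "v \<in> V"
  obtains c where "\<And>x. v x = (\<Sum>i<n. c i *\<^sub>R b i x)"
proof -
  have "v \<in> fun_space.span (b ` {..<n})" using b v by (simp add: is_basis_def)
  then obtain u where "v = (\<Sum>w\<in>b ` {..<n}. (\<lambda>x. u w *\<^sub>R w x))"
    by (subst (asm) fun_space.span_finite) auto
  then have "v = (\<Sum>i<n. (\<lambda>x. u (b i) *\<^sub>R b i x))"
    using b by (simp add: is_basis_def sum.reindex)
  then have "v x = (\<Sum>i<n. u (b i) *\<^sub>R b i x)" for x
    by (simp add: sum_fun_apply)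
  then show thesis by (rule that)
qed

lemma is_basis_coeff_zero:
  fixes b :: "nat \<Rightarrow> 'a \<Rightarrow> 'b::real_vector"
  assumes b: "is_basis n b V" and 0: "\<And>x. (\<Sum>i<n. c i *\<^sub>R b i x) = 0" and i: "i < n"
  shows "c i = 0"
proof -
  have inj: "inj_on b {..<n}" using b by (simp add: is_basis_def)
  \<comment> \<open>Independence is phrased with coefficients attached to the functions themselves;
    injectivity of \<open>b\<close> moves the indexed coefficients over to them.\<close>
  let ?u = "\<lambda>w. c (the_inv_into {..<n} b w)"
  have "(\<Sum>w\<in>b ` {..<n}. (\<lambda>x. ?u w *\<^sub>R w x)) = (\<Sum>i<n. (\<lambda>x. c i *\<^sub>R b i x))"
    using inj by (subst sum.reindex) (auto intro!: sum.cong simp: the_inv_into_f_f)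
  also have "\<dots> = 0"
    by (rule ext) (simp add: sum_fun_apply 0)
  finally have "?u (b i) = 0"
    using b i by (intro fun_space.independentD[of "b ` {..<n}" "b ` {..<n}" ?u]) (auto simp: is_basis_def)
  then show ?thesis using inj i by (simp add: the_inv_into_f_f)
qed

section \<open>Bounded measurable functions and their inner products\<close>

context mesh_domain
begin

text \<open>Since \<Omega> has finite measure, these functions are integrable, and the class is
  closed under sums and pointwise inner products. The trial and test functions belong to it, so
  linearity of the integral is available throughout.\<close>

definition bounded_meas :: "('a \<Rightarrow> 'b::euclidean_space) \<Rightarrow> bool" where
  "bounded_meas f \<longleftrightarrow> f \<in> borel_measurable L \<and> bounded (f ` \<Omega>)"

lemma bounded_measI: "f \<in> borel_measurable L \<Longrightarrow> (\<And>x. x \<in> \<Omega> \<Longrightarrow> norm (f x) \<le> B) \<Longrightarrow> bounded_meas f"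
  unfolding bounded_meas_def bounded_iff by auto

lemma bounded_measD: "bounded_meas f \<Longrightarrow> f \<in> borel_measurable L"
  by (simp add: bounded_meas_def)

lemma bounded_meas_norm: assumes "bounded_meas f" obtains B where "\<And>x. x \<in> \<Omega> \<Longrightarrow> norm (f x) \<le> B"
  using assms unfolding bounded_meas_def bounded_iff by auto

lemma bounded_meas_integrable: "bounded_meas f \<Longrightarrow> integrable L f"
  using finite_measure.integrable_const_bound[OF finite_measure_L, of f]
  by (metis (mono_tags, lifting) AE_I2 bounded_measD bounded_meas_norm space_L)

lemma bounded_meas_const [simp]: "bounded_meas (\<lambda>_. c)"
  by (rule bounded_measI[of _ "norm c"]) auto

lemma bounded_meas_scaleR: "bounded_meas f \<Longrightarrow> bounded_meas (\<lambda>x. c *\<^sub>R f x)"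
proof -
  assume f: "bounded_meas f"
  obtain B where B: "\<And>x. x \<in> \<Omega> \<Longrightarrow> norm (f x) \<le> B" using f by (rule bounded_meas_norm) blast
  show ?thesis
    by (rule bounded_measI[where B = "\<bar>c\<bar> * B"]) (use bounded_measD[OF f] B in \<open>auto intro: mult_left_mono\<close>)
qed

lemma bounded_meas_add: "bounded_meas f \<Longrightarrow> bounded_meas g \<Longrightarrow> bounded_meas (\<lambda>x. f x + g x)"
proof -
  assume f: "bounded_meas f" and g: "bounded_meas g"
  obtain B where B: "\<And>x. x \<in> \<Omega> \<Longrightarrow> norm (f x) \<le> B" using f by (rule bounded_meas_norm) blast
  obtain C where C: "\<And>x. x \<in> \<Omega> \<Longrightarrow> norm (g x) \<le> C" using g by (rule bounded_meas_norm) blast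
  show ?thesis
    by (rule bounded_measI[where B = "B + C"]) (use bounded_measD[OF f] bounded_measD[OF g] B C in \<open>auto intro: norm_triangle_mono\<close>)
qed

lemma bounded_meas_sum: "(\<And>j. j \<in> J \<Longrightarrow> bounded_meas (f j)) \<Longrightarrow> bounded_meas (\<lambda>x. \<Sum>j\<in>J. f j x)"
  by (induction J rule: infinite_finite_induct) (auto intro: bounded_meas_add)

lemma bounded_meas_inner: "bounded_meas f \<Longrightarrow> bounded_meas g \<Longrightarrow> bounded_meas (\<lambda>x. f x \<bullet> g x)"
proof -
  assume f: "bounded_meas f" and g: "bounded_meas g"
  obtain B where B: "\<And>x. x \<in> \<Omega> \<Longrightarrow> norm (f x) \<le> B" using f by (rule bounded_meas_norm) blast
  obtain C where C: "\<And>x. x \<in> \<Omega> \<Longrightarrow> norm (g x) \<le> C" using g by (rule bounded_meas_norm) blast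
  show ?thesis
  proof (rule bounded_measI)
    show "(\<lambda>x. f x \<bullet> g x) \<in> borel_measurable L"
      using bounded_measD[OF f] bounded_measD[OF g] by simp
    show "norm (f x \<bullet> g x) \<le> B * C" if "x \<in> \<Omega>" for x
      using B[OF that] C[OF that] Cauchy_Schwarz_ineq2[of "f x" "g x"]
      by (smt (verit) mult_mono norm_ge_zero real_norm_def)
  qed
qed

lemma bounded_meas_pw_constant: "w \<in> pw_constant \<T> \<Longrightarrow> bounded_meas w"
  unfolding bounded_meas_def using pw_constant_measurable pw_constant_finite_range
  by (meson finite_imp_bounded finite_subset image_mono subset_UNIV)

lemma bounded_meas_pw_linear: "f \<in> pw_linear \<Omega> \<T> \<Longrightarrow> bounded_meas f"
  by (simp add: bounded_meas_def pw_linear_measurable pw_linear_bounded)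

abbreviation ip :: "('a \<Rightarrow> 'b::euclidean_space) \<Rightarrow> ('a \<Rightarrow> 'b) \<Rightarrow> real" where
  "ip \<equiv> L2_inner \<Omega>"

lemma ip_commute: "ip f g = ip g f"
  by (simp add: L2_inner_def inner_commute)

lemma ip_add_left: "bounded_meas f \<Longrightarrow> bounded_meas g \<Longrightarrow> bounded_meas h \<Longrightarrow> ip (\<lambda>x. f x + g x) h = ip f h + ip g h"
  unfolding L2_inner_def inner_add_left
  by (intro Bochner_Integration.integral_add bounded_meas_integrable bounded_meas_inner)

lemma ip_scaleR_left: "ip (\<lambda>x. c *\<^sub>R f x) h = c * ip f h"
  by (simp add: L2_inner_def)

lemma ip_sum_left:
  assumes "\<And>j. j \<in> J \<Longrightarrow> bounded_meas (f j)" "bounded_meas h"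
  shows "ip (\<lambda>x. \<Sum>j\<in>J. c j *\<^sub>R f j x) h = (\<Sum>j\<in>J. c j * ip (f j) h)"
  using assms(1)
proof (induction J rule: infinite_finite_induct)
  case (insert j J)
  then show ?case
    using assms(2) by (simp add: ip_add_left bounded_meas_scaleR bounded_meas_sum ip_scaleR_left)
qed (simp_all add: L2_inner_def)

lemma ip_sum_right:
  assumes "\<And>j. j \<in> J \<Longrightarrow> bounded_meas (f j)" "bounded_meas h"
  shows "ip h (\<lambda>x. \<Sum>j\<in>J. c j *\<^sub>R f j x) = (\<Sum>j\<in>J. c j * ip h (f j))"
  using ip_sum_left[OF assms] by (simp add: ip_commute)

lemma ip_self_eq_zero:
  assumes "bounded_meas f" "ip f f = 0"
  shows "AE x in L. f x = 0"
proof -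
  have "AE x in L. f x \<bullet> f x = 0"
    using assms(2) integral_nonneg_eq_0_iff_AE[OF bounded_meas_integrable[OF bounded_meas_inner[OF assms(1) assms(1)]]]
    by (simp add: L2_inner_def)
  then show ?thesis by simp
qed

text \<open>A change on a null set preserves Lebesgue measurability. This covers
  \<open>grad\<close>, whose values on cell boundaries are unspecified.\<close>

lemma borel_measurable_AE_eq:
  assumes "f \<in> borel_measurable L" "\<And>x. x \<in> mesh_interior \<Longrightarrow> g x = f x"
  shows "(g :: 'a \<Rightarrow> 'b::euclidean_space) \<in> borel_measurable L"
proof -
  \<comment> \<open>The part of \<open>mesh_interior\<close> in \<Omega>, written as a difference to
    match the rule for removing a null set.\<close>
  let ?S = "\<Omega> - (\<Omega> - mesh_interior)"
  have "f \<in> borel_measurable (lebesgue_on ?S)"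
    using assms(1) borel_measurable_diff_null[OF domain_minus_mesh_interior_null domain_measurable] by blast
  then have "g \<in> borel_measurable (lebesgue_on ?S)"
    by (subst measurable_cong[of _ g f]) (use assms(2) in auto)
  then show ?thesis
    using borel_measurable_diff_null[OF domain_minus_mesh_interior_null domain_measurable] by blast
qed

text \<open>Serves to replace \<open>grad\<close> by \<open>dgrad\<close> in the entries of the
  assembled matrices.\<close>

lemma ip_cong_mesh_interior:
  assumes "f \<in> borel_measurable L" "g \<in> borel_measurable L"
    and "\<And>x. x \<in> mesh_interior \<Longrightarrow> f x = f' x" "\<And>x. x \<in> mesh_interior \<Longrightarrow> g x = g' x"
  shows "ip f' g' = ip f g"
  unfolding L2_inner_def
proof (rule integral_cong_AE)
  have "f' \<in> borel_measurable L" "g' \<in> borel_measurable L"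
    using borel_measurable_AE_eq assms by metis+
  then show "(\<lambda>x. f' x \<bullet> g' x) \<in> borel_measurable L" by auto
  show "(\<lambda>x. f x \<bullet> g x) \<in> borel_measurable L" using assms by auto
  show "AE x in L. f' x \<bullet> g' x = f x \<bullet> g x"
    using AE_mesh_interior by eventually_elim (use assms in auto)
qed

lemma pw_linear_eq_zero:
  assumes f: "f \<in> pw_linear \<Omega> \<T>" and 0: "dgrad f = (\<lambda>_. 0)" and int: "ip f (\<lambda>_. 1) = 0"
  shows "f x = 0"
proof -
  obtain c where c: "\<And>x. x \<in> closure \<Omega> \<Longrightarrow> f x = c" by (rule pw_linear_constant[OF f 0]) blast
  \<comment> \<open>As \<open>f\<close> equals \<open>c\<close> on \<Omega>, its squared norm is
    \<open>c\<close> times its integral, hence 0; this gives \<open>c = 0\<close> without computing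
    the measure of \<Omega>.\<close>
  have "ip f f = c * ip f (\<lambda>_. 1)"
    unfolding L2_inner_def
    by (subst integral_mult_right_zero[symmetric], rule Bochner_Integration.integral_cong)
      (use c closure_subset in \<open>auto simp: subset_iff\<close>)
  then have "AE x in L. f x = 0"
    using int by (intro ip_self_eq_zero bounded_meas_pw_linear f) simp
  then obtain y where "y \<in> \<Omega>" "f y = 0"
    using AE_open_ex[of _ \<Omega>] open_domain domain_nonempty by auto
  then have "c = 0" using c closure_subset by auto
  then show ?thesis using c f by (cases "x \<in> closure \<Omega>") (auto simp: pw_linear_def)
qed

text \<open>A nonnegative function with zero integral vanishes almost everywhere, whereas continuity
  makes this one positive on a nonempty open subset of \<Omega>.\<close>

lemma ip_one_pos:
  assumes f: "f \<in> pw_linear \<Omega> \<T>" and v: "\<And>v. v \<in> mesh_vertices \<T> \<Longrightarrow> 0 \<le> f v"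
    and x: "x \<in> closure \<Omega>" "0 < f x"
  shows "ip f (\<lambda>_. 1) \<noteq> 0"
proof
  assume "ip f (\<lambda>_. 1) = 0"
  moreover have "AE x in L. 0 \<le> f x"
    using pw_linear_nonneg[OF f v] closure_subset[of \<Omega>] by (intro AE_I2) auto
  ultimately have "AE x in L. f x = 0"
    using integral_nonneg_eq_0_iff_AE[OF bounded_meas_integrable[OF bounded_meas_pw_linear[OF f]]]
    by (simp add: L2_inner_def)
  moreover have "open (f -` {0<..} \<inter> \<Omega>)"
    using f continuous_on_subset[OF _ closure_subset]
    by (subst Int_commute, intro continuous_open_preimage) (auto simp: pw_linear_def open_domain)
  \<comment> \<open>The point of positivity may lie on the boundary; were \<open>f\<close>
    nonpositive on \<Omega>, continuity would extend this to the closure.\<close>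
  moreover have "f -` {0<..} \<inter> \<Omega> \<noteq> {}"
  proof
    assume "f -` {0<..} \<inter> \<Omega> = {}"
    then have "f ` \<Omega> \<subseteq> {..0}" by force
    then have "f ` closure \<Omega> \<subseteq> {..0}"
      using f by (intro image_closure_subset) (auto simp: pw_linear_def)
    then show False using x by force
  qed
  ultimately obtain y where "y \<in> f -` {0<..} \<inter> \<Omega>" "f y = 0"
    using AE_open_ex by blast
  then show False by auto
qed

end

text \<open>The strict inequality leaves room for a real number between the supremum and 1;
  normalizing a vector by \<open>sgn\<close> extends the bound from unit vectors to all.\<close>

lemma kappa_upper_bound:
  assumes "kappa_upper \<Omega> A < 1"
  obtains k where "k < 1" "\<And>x \<xi>. x \<in> \<Omega> \<Longrightarrow> \<xi> \<bullet> (A x *v \<xi>) \<le> k * (norm \<xi>)\<^sup>2"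
proof -
  obtain r where r: "kappa_upper \<Omega> A < r" "r < 1" using dense[OF assms] by blast
  then obtain k where k: "r = ereal k" by (cases r) auto
  have 1: "\<xi> \<bullet> (A x *v \<xi>) \<le> k" if "x \<in> \<Omega>" "norm \<xi> = 1" for x \<xi>
  proof -
    have "ereal (\<xi> \<bullet> (A x *v \<xi>)) \<le> kappa_upper \<Omega> A"
      unfolding kappa_upper_def using that by (intro SUP_upper2[of x] SUP_upper) auto
    then show ?thesis using r k by (metis ereal_less_eq(3) less_imp_le order_trans)
  qed
  have "\<xi> \<bullet> (A x *v \<xi>) \<le> k * (norm \<xi>)\<^sup>2" if "x \<in> \<Omega>" for x \<xi>
  proof (cases "\<xi> = 0")
    case False
    have "sgn \<xi> \<bullet> (A x *v sgn \<xi>) = (\<xi> \<bullet> (A x *v \<xi>)) / (norm \<xi>)\<^sup>2"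
      by (simp add: sgn_div_norm matrix_vector_mult_scaleR power2_eq_square field_simps)
    then have "(\<xi> \<bullet> (A x *v \<xi>)) / (norm \<xi>)\<^sup>2 \<le> k"
      using 1[OF that, of "sgn \<xi>"] False by (simp add: norm_sgn)
    then show ?thesis
      using False by (simp add: pos_divide_le_eq)
  qed simp
  moreover have "k < 1" using r k by simp
  ultimately show thesis using that by blast
qed

text \<open>The vector entry comes first in each product, matching the position of the coefficients
  in \<open>ip_sum_left\<close>.\<close>

lemma mult_mat_vec_entry:
  fixes v :: "'a::comm_ring_1 Matrix.vec"
  assumes "i < dim_row B" "dim_col B = n" "dim_vec v = n"
  shows "(B *\<^sub>v v) $ i = (\<Sum>j<n. v $ j * B $$ (i, j))"
  using assms by (simp add: scalar_prod_def atLeast0LessThan mult.commute)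

lemma mult_mat_vec_entryI:
  fixes v :: "'a::comm_ring_1 Matrix.vec"
  assumes "i < dim_row B" "dim_col B = n" "dim_vec v = n" "\<And>j. j < n \<Longrightarrow> B $$ (i, j) = f j"
  shows "(B *\<^sub>v v) $ i = (\<Sum>j<n. v $ j * f j)"
  unfolding mult_mat_vec_entry[OF assms(1-3)] by (rule sum.cong) (simp_all add: assms(4))

lemma mat_1_1_mult_vec:
  fixes v :: "'a::comm_ring_1 Matrix.vec"
  assumes "i < dim_row B" "dim_col B = 1" "dim_vec v = 1"
  shows "(B *\<^sub>v v) $ i = v $ 0 * B $$ (i, 0)"
  using mult_mat_vec_entry[OF assms] by simp

subsection \<open>The finite element matrices\<close>

text \<open>The upper bound on the coefficient enters as a real constant \<open>k\<close>, so that
  all further estimates are real arithmetic.\<close>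

locale fem_setting = fem_matrices \<Omega> A \<phi> chi ne0 nt ne + mesh_domain \<Omega> \<T>
  for \<Omega> :: "(real^'d) set"
    and A :: "real^'d \<Rightarrow> real^'d^'d"
    and \<T> :: "(real^'d) set set"
    and \<phi> :: "nat \<Rightarrow> real^'d \<Rightarrow> real"
    and chi :: "nat \<Rightarrow> real^'d \<Rightarrow> real^'d"
    and ne0 nt ne :: nat +
  fixes k :: real
  assumes A_measurable: "A \<in> borel_measurable (lebesgue_on \<Omega>)"
    and A_spd: "\<And>x. x \<in> \<Omega> \<Longrightarrow> sym_pos_def (A x)"
    and phi_basis: "nodal_basis \<Omega> \<T> ne \<phi>"
    and ne0_le: "ne0 \<le> ne" and ne0_pos: "1 \<le> ne0"
    and chi_basis: "is_basis nt chi (pw_constant \<T>)"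
    and k: "k < 1" and A_le: "\<And>x \<xi>. x \<in> \<Omega> \<Longrightarrow> \<xi> \<bullet> (A x *v \<xi>) \<le> k * (norm \<xi>)\<^sup>2"
begin

lemmas P_props = coefficient_inverse_properties[OF A_spd k A_le, folded P_def]

lemma P_sym: "x \<in> \<Omega> \<Longrightarrow> \<xi> \<bullet> (P x *v \<eta>) = (P x *v \<xi>) \<bullet> \<eta>"
  and P_coercive: "x \<in> \<Omega> \<Longrightarrow> (1 - k) * (norm (P x *v \<xi>))\<^sup>2 \<le> (P x *v \<xi>) \<bullet> \<xi>"
  and P_inj: "x \<in> \<Omega> \<Longrightarrow> P x *v \<xi> = 0 \<Longrightarrow> \<xi> = 0"
  and P_bound: "x \<in> \<Omega> \<Longrightarrow> norm (P x *v \<xi>) \<le> norm \<xi> / (1 - k)"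
  using P_props by blast+

text \<open>On \<Omega> the matrix \<open>P x\<close> is \<open>A x\<close> times a single inverse,
  to which Cramer's rule applies.\<close>

lemma P_measurable: "f \<in> borel_measurable L \<Longrightarrow> (\<lambda>x. P x *v f x) \<in> borel_measurable L"
proof -
  assume f: "f \<in> borel_measurable L"
  let ?B = "\<lambda>x. Finite_Cartesian_Product.mat 1 - A x"
  have "P x *v f x = A x *v (matrix_inv (?B x) *v f x)" if "x \<in> \<Omega>" for x
    using coefficient_inverse(2)[OF A_spd[OF that] k A_le[OF that]]
    by (simp add: P_def matrix_vector_mul_assoc)
  moreover have "(\<lambda>x. A x *v (matrix_inv (?B x) *v f x)) \<in> borel_measurable L"
    using coefficient_inverse(1)[OF A_spd k A_le] A_measurable
    by (intro measurable_matrix_vector_mult measurable_matrix_inv_vector_mult f borel_measurable_diff) auto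
  ultimately show ?thesis
    by (subst measurable_cong) auto
qed

lemma bounded_meas_P: "bounded_meas f \<Longrightarrow> bounded_meas (\<lambda>x. P x *v f x)"
proof -
  assume f: "bounded_meas f"
  obtain B where B: "\<And>x. x \<in> \<Omega> \<Longrightarrow> norm (f x) \<le> B" using f by (rule bounded_meas_norm) blast
  show ?thesis
  proof (rule bounded_measI[OF P_measurable[OF bounded_measD[OF f]]])
    show "norm (P x *v f x) \<le> B / (1 - k)" if "x \<in> \<Omega>" for x
      using P_bound[OF that, of "f x"] B[OF that] k
      by (meson diff_gt_0_iff_gt divide_right_mono less_imp_le order_trans)
  qed
qed

lemma ip_P_commute: "ip (\<lambda>x. P x *v f x) g = ip (\<lambda>x. P x *v g x) f"
  unfolding L2_inner_def
proof (rule Bochner_Integration.integral_cong[OF refl])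
  fix x assume "x \<in> space L"
  then have "f x \<bullet> (P x *v g x) = (P x *v f x) \<bullet> g x" using P_sym by simp
  then show "(P x *v f x) \<bullet> g x = (P x *v g x) \<bullet> f x" by (simp only: inner_commute)
qed

lemma P_sum: "(\<lambda>x. P x *v (\<Sum>j\<in>J. c j *\<^sub>R f j x)) = (\<lambda>x. \<Sum>j\<in>J. c j *\<^sub>R (P x *v f j x))"
  by (simp add: linear_sum[OF matrix_vector_mul_linear] matrix_vector_mult_scaleR)

lemma phi_is_basis: "is_basis ne \<phi> (pw_linear \<Omega> \<T>)"
  using phi_basis by (simp add: nodal_basis_def)

lemma phi_pw_linear: "j < ne \<Longrightarrow> \<phi> j \<in> pw_linear \<Omega> \<T>"
  by (rule is_basis_mem[OF phi_is_basis])

abbreviation "d\<phi> j \<equiv> dgrad (\<phi> j)"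

text \<open>The number \<open>n\<close> is \<open>ne0\<close> for the first unknown \<open>u\<close>
  and \<open>ne\<close> for the third unknown \<open>w\<close>; both are expanded in an initial part
  of the same nodal basis.\<close>

definition fe_fun :: "nat \<Rightarrow> real Matrix.vec \<Rightarrow> real^'d \<Rightarrow> real" where
  "fe_fun n u = (\<lambda>x. \<Sum>j<n. u $ j *\<^sub>R \<phi> j x)"

definition fe_grad :: "nat \<Rightarrow> real Matrix.vec \<Rightarrow> real^'d \<Rightarrow> real^'d" where
  "fe_grad n u = (\<lambda>x. \<Sum>j<n. u $ j *\<^sub>R d\<phi> j x)"

definition pc_field :: "real Matrix.vec \<Rightarrow> real^'d \<Rightarrow> real^'d" where
  "pc_field p = (\<lambda>x. \<Sum>j<nt. p $ j *\<^sub>R chi j x)"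

lemma fe_fun_pw_linear: "n \<le> ne \<Longrightarrow> fe_fun n u \<in> pw_linear \<Omega> \<T>"
  unfolding fe_fun_def by (rule pw_linear_sum) (simp add: phi_pw_linear)

lemma dgrad_fe_fun: "n \<le> ne \<Longrightarrow> dgrad (fe_fun n u) = fe_grad n u"
  unfolding fe_fun_def fe_grad_def by (rule ext, rule dgrad_sum) (simp add: phi_pw_linear)

lemma bounded_meas_chi: "j < nt \<Longrightarrow> bounded_meas (chi j)"
  using is_basis_mem[OF chi_basis] by (rule bounded_meas_pw_constant)

lemma bounded_meas_dphi: "j < ne \<Longrightarrow> bounded_meas (d\<phi> j)"
  by (intro bounded_meas_pw_constant dgrad_pw_constant phi_pw_linear)

lemma bounded_meas_fe_grad: "n \<le> ne \<Longrightarrow> bounded_meas (fe_grad n u)"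
  using fe_fun_pw_linear dgrad_fe_fun dgrad_pw_constant bounded_meas_pw_constant by metis

lemma bounded_meas_pc_field: "bounded_meas (pc_field p)"
  unfolding pc_field_def by (intro bounded_meas_sum bounded_meas_scaleR bounded_meas_chi) auto

lemma pw_constant_pc_field:
  assumes "w \<in> pw_constant \<T>"
  obtains c where "dim_vec c = nt" "w = pc_field c"
proof -
  obtain c where "\<And>x. w x = (\<Sum>i<nt. c i *\<^sub>R chi i x)" by (rule is_basis_expansion[OF chi_basis assms]) blast
  then have "w = pc_field (Matrix.vec nt c)" by (auto simp: pc_field_def)
  then show thesis by (intro that[of "Matrix.vec nt c"]) auto
qed

lemma pw_linear_fe_fun:
  assumes "f \<in> pw_linear \<Omega> \<T>"
  obtains c where "dim_vec c = ne" "f = fe_fun ne c"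
proof -
  obtain c where "\<And>x. f x = (\<Sum>i<ne. c i *\<^sub>R \<phi> i x)" by (rule is_basis_expansion[OF phi_is_basis assms]) blast
  then have "f = fe_fun ne (Matrix.vec ne c)" by (auto simp: fe_fun_def)
  then show thesis by (intro that[of "Matrix.vec ne c"]) auto
qed

lemma pc_field_eq_zero:
  assumes "AE x in L. pc_field p x = 0" "dim_vec p = nt"
  shows "p = 0\<^sub>v nt"
proof -
  have "pc_field p \<in> pw_constant \<T>"
    unfolding pc_field_def by (rule is_basis_combination[OF chi_basis])
  then have "pc_field p = (\<lambda>_. 0)" using pw_constant_eq_zero assms by blast
  then have "(\<Sum>i<nt. p $ i *\<^sub>R chi i x) = 0" for x by (simp add: pc_field_def fun_eq_iff)
  then have "p $ i = 0" if "i < nt" for i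
    using is_basis_coeff_zero[OF chi_basis] that by metis
  then show ?thesis using assms(2) by (intro eq_vecI) auto
qed

lemma fe_fun_eq_zero:
  assumes n: "n \<le> ne" and "dim_vec u = n" and "AE x in L. fe_grad n u x = 0" and "ip (fe_fun n u) (\<lambda>_. 1) = 0"
  shows "u = 0\<^sub>v n"
proof -
  have "dgrad (fe_fun n u) = (\<lambda>_. 0)"
    using pw_constant_eq_zero[OF dgrad_pw_constant[OF fe_fun_pw_linear[OF n]]] assms(3)
    by (simp add: dgrad_fe_fun[OF n])
  then have 0: "fe_fun n u x = 0" for x
    using pw_linear_eq_zero[OF fe_fun_pw_linear[OF n]] assms(4) by blast
  \<comment> \<open>Independence concerns all \<open>ne\<close> nodal functions, so the
    \<open>n\<close> coefficients are padded with zeros.\<close>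
  have "(\<Sum>i<ne. (if i < n then u $ i else 0) *\<^sub>R \<phi> i x) = 0" for x
  proof -
    have "(\<Sum>i<ne. (if i < n then u $ i else 0) *\<^sub>R \<phi> i x) = fe_fun n u x"
      unfolding fe_fun_def using n by (intro sum.mono_neutral_cong_right) auto
    then show ?thesis by (simp add: 0)
  qed
  then have *: "(if i < n then u $ i else 0) = 0" if "i < ne" for i
    using is_basis_coeff_zero[OF phi_is_basis, of "\<lambda>i. if i < n then u $ i else 0"] that by blast
  have "u $ i = 0" if "i < n" for i
    using *[of i] that n by simp
  then show ?thesis using assms(2) by (intro eq_vecI) simp_all
qed

section \<open>Assembled matrices as inner products\<close>

lemma K_P_entry: "i < ne0 \<Longrightarrow> j < ne0 \<Longrightarrow> K_P $$ (i, j) = ip (\<lambda>x. P x *v d\<phi> j x) (d\<phi> i)"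
  unfolding K_P_def using ne0_le
  by (simp, intro ip_cong_mesh_interior P_measurable bounded_measD bounded_meas_dphi) (auto simp: dgrad_def)

lemma F_P_entry: "i < ne0 \<Longrightarrow> j < nt \<Longrightarrow> F_P $$ (i, j) = ip (\<lambda>x. P x *v chi j x) (d\<phi> i)"
  unfolding F_P_def using ne0_le
  by (simp, intro ip_cong_mesh_interior P_measurable bounded_measD bounded_meas_dphi bounded_meas_chi) (auto simp: dgrad_def)

lemma M_P_entry: "i < nt \<Longrightarrow> j < nt \<Longrightarrow> M_P $$ (i, j) = ip (\<lambda>x. chi j x + P x *v chi j x) (chi i)"
  unfolding M_P_def by (simp add: matrix_vector_mult_add_rdistrib)

lemma G_entry: "i < nt \<Longrightarrow> j < ne \<Longrightarrow> G $$ (i, j) = ip (d\<phi> j) (chi i)"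
  unfolding G_def by (simp, intro ip_cong_mesh_interior bounded_measD bounded_meas_dphi bounded_meas_chi) (auto simp: dgrad_def)

lemma dims_fem [simp]:
  "dim_row K_P = ne0" "dim_col K_P = ne0" "dim_row F_P = ne0" "dim_col F_P = nt"
  "dim_row M_P = nt" "dim_col M_P = nt" "dim_row G = nt" "dim_col G = ne"
  "dim_row X = ne0" "dim_col X = ne0" "dim_row Y = ne0" "dim_col Y = ne"
  "dim_row \<alpha> = ne0" "dim_col \<alpha> = 1" "dim_row \<beta> = ne" "dim_col \<beta> = 1"
  by (simp_all add: K_P_def F_P_def M_P_def G_def X_def Y_def \<alpha>_def \<beta>_def)

text \<open>Linearity turns each row of a matrix-vector product into a weak form of the represented
  function, tested with the basis function of that row; the other blocks are treated alike.\<close>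

lemma K_P_vec:
  assumes "dim_vec u = ne0" "i < ne0"
  shows "(K_P *\<^sub>v u) $ i = ip (\<lambda>x. P x *v fe_grad ne0 u x) (d\<phi> i)"
proof -
  have "(K_P *\<^sub>v u) $ i = (\<Sum>j<ne0. u $ j * ip (\<lambda>x. P x *v d\<phi> j x) (d\<phi> i))"
    by (rule mult_mat_vec_entryI) (use assms in \<open>simp_all add: K_P_entry\<close>)
  also have "\<dots> = ip (\<lambda>x. P x *v fe_grad ne0 u x) (d\<phi> i)"
    unfolding fe_grad_def P_sum
    by (rule ip_sum_left[symmetric]) (use assms ne0_le in \<open>simp_all add: bounded_meas_P bounded_meas_dphi\<close>)
  finally show ?thesis .
qed

lemma F_P_vec:
  assumes "dim_vec p = nt" "i < ne0"
  shows "(F_P *\<^sub>v p) $ i = ip (\<lambda>x. P x *v pc_field p x) (d\<phi> i)"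
proof -
  have "(F_P *\<^sub>v p) $ i = (\<Sum>j<nt. p $ j * ip (\<lambda>x. P x *v chi j x) (d\<phi> i))"
    by (rule mult_mat_vec_entryI) (use assms in \<open>simp_all add: F_P_entry\<close>)
  also have "\<dots> = ip (\<lambda>x. P x *v pc_field p x) (d\<phi> i)"
    unfolding pc_field_def P_sum
    by (rule ip_sum_left[symmetric]) (use assms ne0_le in \<open>simp_all add: bounded_meas_P bounded_meas_dphi bounded_meas_chi\<close>)
  finally show ?thesis .
qed

text \<open>Transposing puts the sum into the test function; the symmetry of \<open>P\<close> then
  moves the coefficient onto the represented gradient.\<close>

lemma F_P_transpose_vec:
  assumes "dim_vec u = ne0" "i < nt"
  shows "(transpose_mat F_P *\<^sub>v u) $ i = ip (\<lambda>x. P x *v fe_grad ne0 u x) (chi i)"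
proof -
  have "(transpose_mat F_P *\<^sub>v u) $ i = (\<Sum>j<ne0. u $ j * ip (\<lambda>x. P x *v chi i x) (d\<phi> j))"
    by (rule mult_mat_vec_entryI) (use assms in \<open>simp_all add: F_P_entry\<close>)
  also have "\<dots> = ip (\<lambda>x. P x *v chi i x) (fe_grad ne0 u)"
    unfolding fe_grad_def
    by (rule ip_sum_right[symmetric]) (use assms ne0_le in \<open>simp_all add: bounded_meas_P bounded_meas_dphi bounded_meas_chi\<close>)
  finally show ?thesis by (simp add: ip_P_commute)
qed

lemma M_P_vec:
  assumes "dim_vec p = nt" "i < nt"
  shows "(M_P *\<^sub>v p) $ i = ip (\<lambda>x. pc_field p x + P x *v pc_field p x) (chi i)"
proof -
  have "(M_P *\<^sub>v p) $ i = (\<Sum>j<nt. p $ j * ip (\<lambda>x. chi j x + P x *v chi j x) (chi i))"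
    by (rule mult_mat_vec_entryI) (use assms in \<open>simp_all add: M_P_entry\<close>)
  also have "\<dots> = ip (\<lambda>x. \<Sum>j<nt. p $ j *\<^sub>R (chi j x + P x *v chi j x)) (chi i)"
    by (rule ip_sum_left[symmetric]) (use assms in \<open>simp_all add: bounded_meas_P bounded_meas_add bounded_meas_chi\<close>)
  also have "(\<lambda>x. \<Sum>j<nt. p $ j *\<^sub>R (chi j x + P x *v chi j x)) = (\<lambda>x. pc_field p x + P x *v pc_field p x)"
    by (simp add: pc_field_def linear_sum[OF matrix_vector_mul_linear] matrix_vector_mult_scaleR
        scaleR_add_right sum.distrib)
  finally show ?thesis .
qed

lemma G_vec:
  assumes "dim_vec w = ne" "i < nt"
  shows "(G *\<^sub>v w) $ i = ip (fe_grad ne w) (chi i)"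
proof -
  have "(G *\<^sub>v w) $ i = (\<Sum>j<ne. w $ j * ip (d\<phi> j) (chi i))"
    by (rule mult_mat_vec_entryI) (use assms in \<open>simp_all add: G_entry\<close>)
  also have "\<dots> = ip (fe_grad ne w) (chi i)"
    unfolding fe_grad_def by (rule ip_sum_left[symmetric]) (use assms in \<open>simp_all add: bounded_meas_dphi bounded_meas_chi\<close>)
  finally show ?thesis .
qed

lemma G_transpose_vec:
  assumes "dim_vec p = nt" "i < ne"
  shows "(transpose_mat G *\<^sub>v p) $ i = ip (pc_field p) (d\<phi> i)"
proof -
  have "(transpose_mat G *\<^sub>v p) $ i = (\<Sum>j<nt. p $ j * ip (d\<phi> i) (chi j))"
    by (rule mult_mat_vec_entryI) (use assms in \<open>simp_all add: G_entry\<close>)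
  also have "\<dots> = ip (d\<phi> i) (pc_field p)"
    unfolding pc_field_def by (rule ip_sum_right[symmetric]) (use assms in \<open>simp_all add: bounded_meas_dphi bounded_meas_chi\<close>)
  finally show ?thesis by (simp add: ip_commute)
qed

lemma \<alpha>_vec: "dim_vec s = 1 \<Longrightarrow> i < ne0 \<Longrightarrow> (\<alpha> *\<^sub>v s) $ i = s $ 0 * ip (\<phi> i) (\<lambda>_. 1)"
  by (subst mat_1_1_mult_vec) (simp_all, simp add: \<alpha>_def)

lemma \<beta>_vec: "dim_vec s = 1 \<Longrightarrow> i < ne \<Longrightarrow> (\<beta> *\<^sub>v s) $ i = s $ 0 * ip (\<phi> i) (\<lambda>_. 1)"
  by (subst mat_1_1_mult_vec) (simp_all, simp add: \<beta>_def)

lemma ip_fe_fun_one: "n \<le> ne \<Longrightarrow> ip (fe_fun n u) (\<lambda>_. 1) = (\<Sum>i<n. u $ i * ip (\<phi> i) (\<lambda>_. 1))"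
  unfolding fe_fun_def by (rule ip_sum_left) (simp_all add: bounded_meas_pw_linear phi_pw_linear)

lemma \<alpha>_transpose_vec: "dim_vec u = ne0 \<Longrightarrow> (transpose_mat \<alpha> *\<^sub>v u) $ 0 = ip (fe_fun ne0 u) (\<lambda>_. 1)"
  using ne0_le by (subst mult_mat_vec_entry) (simp_all, simp add: ip_fe_fun_one \<alpha>_def)

lemma \<beta>_transpose_vec: "dim_vec w = ne \<Longrightarrow> (transpose_mat \<beta> *\<^sub>v w) $ 0 = ip (fe_fun ne w) (\<lambda>_. 1)"
  by (subst mult_mat_vec_entry) (simp_all, simp add: ip_fe_fun_one \<beta>_def)

end

text \<open>As \<open>B\<close> is symmetric, the transpose of \<open>C\<close> is a left inverse of
  \<open>B\<close>, and it coincides with the right inverse \<open>C\<close>.\<close>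

lemma transpose_inverse_mat:
  fixes B C :: "'a::field mat"
  assumes B: "B \<in> carrier_mat n n" and C: "C \<in> carrier_mat n n"
    and sym: "transpose_mat B = B" and inv: "B * C = 1\<^sub>m n"
  shows "transpose_mat C = C"
proof -
  have "transpose_mat C * B = 1\<^sub>m n"
    using transpose_mult[OF B C] inv sym by simp
  then have "transpose_mat C * (B * C) = C"
    using B C by (simp flip: assoc_mult_mat[of _ n n _ n _ n])
  then show ?thesis using inv C by simp
qed

section \<open>Definiteness and nonsingularity\<close>

context fem_setting
begin

lemma ip_P_integrand_nonneg: "x \<in> \<Omega> \<Longrightarrow> 0 \<le> (P x *v \<xi>) \<bullet> \<xi>"
  using P_coercive[of x \<xi>] k by (smt (verit) mult_nonneg_nonneg zero_le_power2)

lemma ip_P_nonneg: "0 \<le> ip (\<lambda>x. P x *v f x) f"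
  unfolding L2_inner_def by (rule integral_nonneg_AE) (auto intro!: AE_I2 ip_P_integrand_nonneg)

text \<open>A nonnegative integrand with zero integral vanishes almost everywhere. At such points
  coercivity gives \<open>P x *v f x = 0\<close>, and injectivity gives
  \<open>f x = 0\<close>.\<close>

lemma ip_P_eq_zero:
  assumes f: "bounded_meas f" and 0: "ip (\<lambda>x. P x *v f x) f = 0"
  shows "AE x in L. f x = 0"
proof -
  have nonneg: "AE x in L. 0 \<le> (P x *v f x) \<bullet> f x"
    by (rule AE_I2) (simp add: ip_P_integrand_nonneg)
  have "AE x in L. (P x *v f x) \<bullet> f x = 0"
    using 0 integral_nonneg_eq_0_iff_AE[OF bounded_meas_integrable[OF bounded_meas_inner[OF bounded_meas_P[OF f] f]] nonneg]
    by (simp add: L2_inner_def)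
  moreover have "AE x in L. x \<in> \<Omega>" by (rule AE_I2) simp
  ultimately show ?thesis
  proof eventually_elim
    case (elim x)
    then have "(1 - k) * (norm (P x *v f x))\<^sup>2 \<le> 0" using P_coercive[of x "f x"] by simp
    then have "P x *v f x = 0" using k by (simp add: mult_le_0_iff)
    then show ?case using P_inj elim by blast
  qed
qed

lemma ip_self_nonneg: "0 \<le> ip f f"
  unfolding L2_inner_def by (rule integral_nonneg_AE) simp

lemma ip_pc_field: "bounded_meas h \<Longrightarrow> ip h (pc_field p) = (\<Sum>i<nt. p $ i * ip h (chi i))"
  unfolding pc_field_def by (rule ip_sum_right) (simp_all add: bounded_meas_chi)

lemma ip_fe_grad: "n \<le> ne \<Longrightarrow> bounded_meas h \<Longrightarrow> ip h (fe_grad n u) = (\<Sum>i<n. u $ i * ip h (d\<phi> i))"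
  unfolding fe_grad_def by (rule ip_sum_right) (simp_all add: bounded_meas_dphi)

text \<open>Pairing \<open>M_P *\<^sub>v p\<close> with \<open>p\<close> gives the squared norm of
  the represented field plus a nonnegative term, so a kernel vector represents the zero
  field.\<close>

lemma det_M_P: "Determinant.det M_P \<noteq> 0"
proof (rule det_nonzeroI)
  show "M_P \<in> carrier_mat nt nt" by (intro carrier_matI) simp_all
  fix p assume "p \<in> carrier_vec nt" and 0: "M_P *\<^sub>v p = 0\<^sub>v nt"
  then have d: "dim_vec p = nt" by simp
  have bounded_meas: "bounded_meas (\<lambda>x. pc_field p x + P x *v pc_field p x)" by (intro bounded_meas_add bounded_meas_P bounded_meas_pc_field)
  have "ip (\<lambda>x. pc_field p x + P x *v pc_field p x) (pc_field p) = 0"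
    unfolding ip_pc_field[OF bounded_meas]
    using 0 by (simp add: M_P_vec[OF d, symmetric])
  then have "ip (pc_field p) (pc_field p) + ip (\<lambda>x. P x *v pc_field p x) (pc_field p) = 0"
    by (simp add: ip_add_left bounded_meas_P bounded_meas_pc_field)
  then have "ip (pc_field p) (pc_field p) = 0"
    using ip_P_nonneg[of "pc_field p"] ip_self_nonneg[of "pc_field p"] by linarith
  then show "p = 0\<^sub>v nt"
    by (intro pc_field_eq_zero ip_self_eq_zero bounded_meas_pc_field d)
qed

lemma M_P_sym: "transpose_mat M_P = M_P"
proof (rule eq_matI)
  fix i j assume ij: "i < dim_row M_P" "j < dim_col M_P"
  then have "ip (\<lambda>x. chi i x + P x *v chi i x) (chi j) = ip (\<lambda>x. chi j x + P x *v chi j x) (chi i)"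
    by (simp add: ip_add_left bounded_meas_P bounded_meas_chi ip_commute[of "chi i"] ip_P_commute[of "chi i"])
  then show "transpose_mat M_P $$ (i, j) = M_P $$ (i, j)"
    using ij by (simp add: M_P_entry)
qed simp_all

lemma M_P_inv: "M_P_inv \<in> carrier_mat nt nt" "M_P * M_P_inv = 1\<^sub>m nt"
proof -
  have M: "M_P \<in> carrier_mat nt nt" by (intro carrier_matI) simp_all
  \<comment> \<open>A nonsingular matrix is a unit of the matrix ring, and
    \<open>mat_inverse\<close> fails only for non-units. The parameter \<open>b\<close> fills the
    extension slot of the ring record; it is fixed so that both facts speak of the same
    ring.\<close>
  have "mat_inverse M_P \<noteq> None"
    using mat_inverse(1)[OF M, where b = "()"] det_non_zero_imp_unit[OF M det_M_P, where b = "()"]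
    by blast
  then have "mat_inverse M_P = Some M_P_inv" by (simp add: M_P_inv_def)
  then show "M_P_inv \<in> carrier_mat nt nt" "M_P * M_P_inv = 1\<^sub>m nt"
    using mat_inverse(2)[OF M] by auto
qed

lemma real_block_elimination:
  "real_block_elimination ne0 nt ne K_P F_P M_P M_P_inv G X Y \<alpha> \<beta>"
proof -
  have "M_P \<in> carrier_mat nt nt" by (intro carrier_matI) simp_all
  from transpose_inverse_mat[OF this M_P_inv(1) M_P_sym M_P_inv(2)] M_P_inv show ?thesis
    by unfold_locales simp_all
qed

lemma dgrad_indicator: "dgrad (indicator (closure \<Omega>)) = (\<lambda>_. 0)"
proof
  fix x show "dgrad (indicator (closure \<Omega>)) x = 0"
  proof (cases "x \<in> mesh_interior")
    case True
    then obtain T where T: "T \<in> \<T>" "x \<in> interior T" by (auto simp: mesh_interior_def)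
    have "indicator (closure \<Omega>) y = 0 \<bullet> y + (1::real)" if "y \<in> T" for y
      using cell_subset[OF T(1)] that by auto
    then have "grad (indicator (closure \<Omega>)) x = 0" using T(2) by (rule grad_affine)
    then show ?thesis by (simp add: dgrad_def)
  qed (simp add: dgrad_def)
qed

text \<open>A nodal function is 1 at its own vertex and 0 at the others, hence nonnegative at all
  vertices and positive at one point of the closure.\<close>

lemma ip_phi_nonzero:
  assumes "i < ne"
  shows "ip (\<phi> i) (\<lambda>_. 1) \<noteq> 0"
proof -
  obtain q where q: "bij_betw q {..<ne} (mesh_vertices \<T>)"
    and node: "\<And>i j. i < ne \<Longrightarrow> j < ne \<Longrightarrow> \<phi> i (q j) = (if i = j then 1 else 0)"
    using phi_basis unfolding nodal_basis_def by blast
  have v: "0 \<le> \<phi> i v" if "v \<in> mesh_vertices \<T>" for v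
  proof -
    have "v \<in> q ` {..<ne}" using that q by (simp add: bij_betw_def)
    then obtain j where "j < ne" "v = q j" by blast
    then show ?thesis using node[OF assms, of j] by simp
  qed
  have "q i \<in> mesh_vertices \<T>" using q assms unfolding bij_betw_def by auto
  then have "q i \<in> closure \<Omega>"
    using cell_subset unfolding mesh_vertices_def extreme_point_of_def by auto
  then show ?thesis
    using ip_one_pos[OF phi_pw_linear[OF assms] v, of "q i"] node[OF assms assms] by simp
qed

text \<open>The unknowns are shown to vanish in the order \<open>t\<close>, \<open>p\<close>,
  \<open>u\<close>, \<open>s\<close>, \<open>w\<close>, each step relying on the earlier
  ones.\<close>

lemma kernel_trivial:
  assumes d: "dim_vec p = nt" "dim_vec u = ne0" "dim_vec w = ne" "dim_vec s = 1" "dim_vec t = 1"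
    and e1: "K_P *\<^sub>v u + (F_P *\<^sub>v p + \<alpha> *\<^sub>v s) = 0\<^sub>v ne0"
    and e2: "transpose_mat F_P *\<^sub>v u + (M_P *\<^sub>v p + - G *\<^sub>v w) = 0\<^sub>v nt"
    and e3: "- transpose_mat G *\<^sub>v p + \<beta> *\<^sub>v t = 0\<^sub>v ne"
    and e4: "transpose_mat \<alpha> *\<^sub>v u = 0\<^sub>v 1" and e5: "transpose_mat \<beta> *\<^sub>v w = 0\<^sub>v 1"
  shows "u = 0\<^sub>v ne0 \<and> p = 0\<^sub>v nt \<and> w = 0\<^sub>v ne \<and> s = 0\<^sub>v 1 \<and> t = 0\<^sub>v 1"
proof -
  let ?U = "fe_grad ne0 u" and ?W = "fe_grad ne w" and ?q = "pc_field p"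
  have bmU: "bounded_meas ?U" and bmW: "bounded_meas ?W" and bmq: "bounded_meas ?q"
    using ne0_le by (simp_all add: bounded_meas_fe_grad bounded_meas_pc_field)
  have c1: "ip (\<lambda>x. P x *v ?U x) (d\<phi> i) + (ip (\<lambda>x. P x *v ?q x) (d\<phi> i) + s $ 0 * ip (\<phi> i) (\<lambda>_. 1)) = 0"
    if "i < ne0" for i
    using arg_cong[OF e1, of "\<lambda>v. vec_index v i"] that d
    by (simp add: K_P_vec F_P_vec \<alpha>_vec del: index_mult_mat_vec)
  have c2: "ip (\<lambda>x. P x *v ?U x) (chi i) + (ip (\<lambda>x. ?q x + P x *v ?q x) (chi i) - ip ?W (chi i)) = 0"
    if "i < nt" for i
    using arg_cong[OF e2, of "\<lambda>v. vec_index v i"] that d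
    by (simp add: F_P_transpose_vec M_P_vec G_vec uminus_mat_mult_vec del: index_mult_mat_vec)
  have c3: "- ip ?q (d\<phi> i) + t $ 0 * ip (\<phi> i) (\<lambda>_. 1) = 0" if "i < ne" for i
    using arg_cong[OF e3, of "\<lambda>v. vec_index v i"] that d
    by (simp add: G_transpose_vec \<beta>_vec uminus_mat_mult_vec del: index_mult_mat_vec)
  have c4: "ip (fe_fun ne0 u) (\<lambda>_. 1) = 0" and c5: "ip (fe_fun ne w) (\<lambda>_. 1) = 0"
    using arg_cong[OF e4, of "\<lambda>v. vec_index v 0"] arg_cong[OF e5, of "\<lambda>v. vec_index v 0"] d
    by (simp_all add: \<alpha>_transpose_vec \<beta>_transpose_vec del: index_mult_mat_vec)
  \<comment> \<open>The test function stays arbitrary because two choices follow: the constant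
    function determines \<open>t\<close>, and \<open>w\<close> itself then removes the coupling term
    between \<open>?W\<close> and \<open>?q\<close>.\<close>
  have s3: "ip ?q (fe_grad ne y) = t $ 0 * ip (fe_fun ne y) (\<lambda>_. 1)" for y
  proof -
    have "ip ?q (fe_grad ne y) = (\<Sum>i<ne. y $ i * (t $ 0 * ip (\<phi> i) (\<lambda>_. 1)))"
      unfolding ip_fe_grad[OF order_refl bmq] using c3 by (intro sum.cong) auto
    also have "\<dots> = t $ 0 * ip (fe_fun ne y) (\<lambda>_. 1)"
      by (simp add: ip_fe_fun_one sum_distrib_left mult_ac)
    finally show ?thesis .
  qed
  \<comment> \<open>The constant 1 has zero gradient but nonzero integral, so only the term with
    \<open>t\<close> survives.\<close>
  have t0: "t $ 0 = 0"
  proof -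
    obtain y where y: "indicator (closure \<Omega>) = fe_fun ne y" by (rule pw_linear_fe_fun[OF indicator_pw_linear])
    have "fe_grad ne y = (\<lambda>_. 0)" using dgrad_fe_fun[of ne y] dgrad_indicator y by simp
    then have "t $ 0 * ip (fe_fun ne y) (\<lambda>_. 1) = 0" using s3[of y] by (simp add: L2_inner_def)
    moreover obtain x where "x \<in> closure \<Omega>"
      using domain_nonempty closure_subset[of \<Omega>] by blast
    then have "ip (indicator (closure \<Omega>)) (\<lambda>_. 1 :: real) \<noteq> 0"
      by (intro ip_one_pos[OF indicator_pw_linear, of x]) auto
    ultimately show ?thesis by (simp add: y)
  qed
  \<comment> \<open>The first row tested with \<open>u\<close>; the multiplier \<open>s\<close>
    drops out because \<open>fe_fun ne0 u\<close> has zero integral.\<close>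
  have s1: "ip (\<lambda>x. P x *v ?U x) ?U + ip (\<lambda>x. P x *v ?q x) ?U = 0"
  proof -
    have "ip (\<lambda>x. P x *v ?U x) ?U + ip (\<lambda>x. P x *v ?q x) ?U + s $ 0 * ip (fe_fun ne0 u) (\<lambda>_. 1)
        = (\<Sum>i<ne0. u $ i * (ip (\<lambda>x. P x *v ?U x) (d\<phi> i) + (ip (\<lambda>x. P x *v ?q x) (d\<phi> i) + s $ 0 * ip (\<phi> i) (\<lambda>_. 1))))"
      unfolding ip_fe_grad[OF ne0_le bounded_meas_P[OF bmU]] ip_fe_grad[OF ne0_le bounded_meas_P[OF bmq]] ip_fe_fun_one[OF ne0_le]
      by (simp add: sum.distrib sum_distrib_left algebra_simps)
    also have "\<dots> = 0" using c1 by (intro sum.neutral) simp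
    finally show ?thesis using c4 by simp
  qed
  have s2: "ip (\<lambda>x. P x *v ?U x) ?q + (ip (\<lambda>x. ?q x + P x *v ?q x) ?q - ip ?W ?q) = 0"
  proof -
    have "ip (\<lambda>x. P x *v ?U x) ?q + (ip (\<lambda>x. ?q x + P x *v ?q x) ?q - ip ?W ?q)
        = (\<Sum>i<nt. p $ i * (ip (\<lambda>x. P x *v ?U x) (chi i) + (ip (\<lambda>x. ?q x + P x *v ?q x) (chi i) - ip ?W (chi i))))"
      unfolding ip_pc_field[OF bounded_meas_P[OF bmU]] ip_pc_field[OF bounded_meas_add[OF bmq bounded_meas_P[OF bmq]]] ip_pc_field[OF bmW]
      by (simp add: sum.distrib sum_subtractf algebra_simps)
    also have "\<dots> = 0" using c2 by (intro sum.neutral) simp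
    finally show ?thesis .
  qed
  have Wq: "ip ?W ?q = 0" using s3[of w] t0 by (simp add: ip_commute)
  let ?f = "\<lambda>x. ?U x + ?q x"
  have bmf: "bounded_meas ?f" by (intro bounded_meas_add bmU bmq)
  have "ip (\<lambda>x. P x *v ?f x) ?f = ip ?f (\<lambda>x. P x *v ?U x + P x *v ?q x)"
    by (simp add: matrix_vector_right_distrib ip_commute)
  also have "\<dots> = ip (\<lambda>x. P x *v ?U x) ?U + ip (\<lambda>x. P x *v ?q x) ?U
      + (ip (\<lambda>x. P x *v ?U x) ?q + ip (\<lambda>x. P x *v ?q x) ?q)"
  proof -
    have *: "ip h (\<lambda>x. P x *v ?U x + P x *v ?q x) = ip (\<lambda>x. P x *v ?U x) h + ip (\<lambda>x. P x *v ?q x) h" if "bounded_meas h" for h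
      using ip_add_left[OF bounded_meas_P[OF bmU] bounded_meas_P[OF bmq] that] by (simp add: ip_commute)
    show ?thesis
      using ip_add_left[OF bmU bmq bounded_meas_add[OF bounded_meas_P[OF bmU] bounded_meas_P[OF bmq]]] *[OF bmU] *[OF bmq] by simp
  qed
  \<comment> \<open>Adding the rows tested with \<open>u\<close> and \<open>p\<close> completes the
    square: what remains is the \<open>P\<close>-energy of \<open>?f\<close> and the squared norm of
    \<open>?q\<close>, both nonnegative.\<close>
  finally have energy: "ip (\<lambda>x. P x *v ?f x) ?f + ip ?q ?q = 0"
    using s1 s2 Wq ip_add_left[OF bmq bounded_meas_P[OF bmq] bmq] by simp
  have qq: "ip ?q ?q = 0" and ff: "ip (\<lambda>x. P x *v ?f x) ?f = 0"
    using energy ip_P_nonneg[of ?f] ip_self_nonneg[of ?q] by linarith+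
  have q0: "AE x in L. ?q x = 0" by (rule ip_self_eq_zero[OF bmq qq])
  then have p: "p = 0\<^sub>v nt" by (rule pc_field_eq_zero) (rule d)
  have "AE x in L. ?U x = 0"
    using q0 ip_P_eq_zero[OF bmf ff] by eventually_elim simp
  then have u: "u = 0\<^sub>v ne0"
    by (rule fe_fun_eq_zero[OF ne0_le d(2) _ c4])
  \<comment> \<open>Positivity of \<open>ne0\<close> provides a row of the first block; once
    \<open>u\<close> and \<open>p\<close> vanish, it contains only \<open>s\<close> times a nonzero
    integral.\<close>
  have "0 < ne0" using ne0_pos by simp
  have "s $ 0 * ip (\<phi> 0) (\<lambda>_. 1) = 0"
    using arg_cong[OF e1, of "\<lambda>v. vec_index v 0"] \<open>0 < ne0\<close> d
    by (simp add: u p mult_mat_zero_vec \<alpha>_vec del: index_mult_mat_vec)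
  then have s0: "s $ 0 = 0"
    using ip_phi_nonzero[of 0] \<open>0 < ne0\<close> ne0_le by simp
  have Wchi: "ip ?W (chi i) = 0" if "i < nt" for i
    using arg_cong[OF e2, of "\<lambda>v. vec_index v i"] that d
    by (simp add: u p mult_mat_zero_vec G_vec uminus_mat_mult_vec del: index_mult_mat_vec)
  \<comment> \<open>\<open>?W\<close> lies in the span of the fields \<open>chi i\<close>, to all of
    which it is orthogonal, so it is orthogonal to itself.\<close>
  have "?W \<in> pw_constant \<T>"
    using dgrad_pw_constant[OF fe_fun_pw_linear[OF order_refl, of w]] by (simp add: dgrad_fe_fun)
  then obtain y where "?W = pc_field y" by (rule pw_constant_pc_field)
  then have "ip ?W ?W = 0" using ip_pc_field[OF bmW, of y] Wchi by simp
  then have w: "w = 0\<^sub>v ne"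
    by (intro fe_fun_eq_zero[OF order_refl d(3) _ c5] ip_self_eq_zero bmW)
  have "s = 0\<^sub>v 1" "t = 0\<^sub>v 1"
    using s0 t0 d by (auto intro!: eq_vecI)
  then show ?thesis using u p w by simp
qed

lemma pencil_reduction:
  defines "K \<equiv> map_mat complex_of_real cal_K" and "M \<equiv> map_mat complex_of_real cal_M"
    and "K' \<equiv> map_mat complex_of_real cal_K_hat" and "M' \<equiv> map_mat complex_of_real cal_M_hat"
  shows "regular_pencil K M \<and> regular_pencil K' M' \<and>
        (\<forall>\<mu>. pencil_eigenvalue K M \<mu> \<longleftrightarrow> pencil_eigenvalue K' M' \<mu>) \<and>
        replicate_mset nt Infinite \<subseteq># pencil_spec K M \<and>
        pencil_spec K' M' = pencil_spec K M - replicate_mset nt Infinite"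
proof -
  interpret be: real_block_elimination ne0 nt ne K_P F_P M_P M_P_inv G X Y \<alpha> \<beta>
    by (rule real_block_elimination)
  \<comment> \<open>The abstract blocks are instantiated so that both sides unfold to the same
    term.\<close>
  have eqs: "cal_K = be.cK" "cal_M = be.cM" "cal_K_hat = be.cK_hat" "cal_M_hat = be.cM_hat"
    unfolding cal_K_def be.cK_def cal_M_def be.cM_def cal_K_hat_def be.cK_hat_def cal_M_hat_def be.cM_hat_def
      K_hat_def F_hat_def G_hat_def by (rule refl)+
  have "Determinant.det be.cK \<noteq> 0"
    by (rule be.det_cK_nonzeroI) (rule kernel_trivial)
  then show ?thesis
    unfolding K_def M_def K'_def M'_def eqs by (rule be.pencil_elimination)
qed

end

theorem theorem4p1:
  fixes \<Omega> :: "(real^'d) set"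
    and A :: "real^'d \<Rightarrow> real^'d^'d"
    and \<T> :: "(real^'d) set set"
    and \<phi> :: "nat \<Rightarrow> real^'d \<Rightarrow> real"
    and chi :: "nat \<Rightarrow> real^'d \<Rightarrow> real^'d"
    and ne0 nt ne :: nat
  assumes dim: "CARD('d) = 2 \<or> CARD('d) = 3"
    and domain: "polyhedral_domain \<Omega>"
    and A_measurable: "A \<in> borel_measurable (lebesgue_on \<Omega>)"
    and A_spd: "\<forall>x\<in>\<Omega>. sym_pos_def (A x)"
    and mesh: "simplicial_mesh \<Omega> \<T>"
    and phi_basis: "nodal_basis \<Omega> \<T> ne \<phi>"
    and phi_basis0: "ne0 \<le> ne" "is_basis ne0 \<phi> (pw_linear0 \<Omega> \<T>)"
    and chi_basis: "is_basis nt chi (pw_constant \<T>)"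
    and ne0_pos: "1 \<le> ne0"
    and kappa: "0 < kappa_lower \<Omega> A" "kappa_lower \<Omega> A \<le> kappa_upper \<Omega> A" "kappa_upper \<Omega> A < 1"
  shows
    "let K = map_mat complex_of_real (fem_matrices.cal_K \<Omega> A \<phi> chi ne0 nt ne);
         M = map_mat complex_of_real (fem_matrices.cal_M \<Omega> \<phi> ne0 nt ne);
         K' = map_mat complex_of_real (fem_matrices.cal_K_hat \<Omega> A \<phi> chi ne0 nt ne);
         M' = map_mat complex_of_real (fem_matrices.cal_M_hat \<Omega> \<phi> ne0 ne)
     in regular_pencil K M \<and> regular_pencil K' M' \<and>
        (\<forall>\<mu>. pencil_eigenvalue K M \<mu> \<longleftrightarrow> pencil_eigenvalue K' M' \<mu>) \<and>
        replicate_mset nt Infinite \<subseteq># pencil_spec K M \<and>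
        pencil_spec K' M' = pencil_spec K M - replicate_mset nt Infinite"
proof -
  obtain k where k: "k < 1" "\<And>x \<xi>. x \<in> \<Omega> \<Longrightarrow> \<xi> \<bullet> (A x *v \<xi>) \<le> k * (norm \<xi>)\<^sup>2"
    by (rule kappa_upper_bound[OF kappa(3)]) blast
  interpret fem_setting \<Omega> A \<T> \<phi> chi ne0 nt ne k
    by unfold_locales (use assms k in auto)
  show ?thesis
    unfolding Let_def by (rule pencil_reduction)
qed

end
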